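(* Consider the Dirichlet problem $-y''+q(x)y=\lambda y$ on $[0,b]$, $y(0)=0$, $y(b)=0$, with characteristic function $\Phi(\omega)=-s(\omega,b;\infty)$, $\lambda=\omega^2$, and approximate characteristic function $\Phi_N(\omega)=-s_N(\omega,b)$. For every $\varepsilon>0$ there exist $\varepsilon_1>0$ and $\varepsilon_2>0$ such that the following holds: if for some $N$ and some complex numbers $a_0,\dots,a_N,b_1,\dots,b_N$ the inequalities $$\left\vert \frac{h}{2}+\frac{1}{4}\int_{0}^{x}q(s)\,ds-\sum_{n=0}^{N}a_{n}\mathbf{c}_{n}(x)\right\vert <\varepsilon _{1},\qquad \left\vert \frac{1}{4}\int_{0}^{x}q(s)\,ds-\sum_{n=1}^{N}b_{n}\mathbf{s}_{n}(x)\right\vert <\varepsilon _{2}$$ are satisfied for every $x\in[0,b]$, then all the zeros (including multiplicities) of $\Phi$ are approximated by the complex zeros of $\Phi_N$ with errors uniformly bounded by $\varepsilon$, and no spurious zeros appear; that is, there is a bijection between the zeros of $\Phi$ in $\mathbb{C}$ and the zeros of $\Phi_N$ in $\mathbb{C}$, both counted with multiplicity, such that corresponding zeros differ by at most $\varepsilon$ in absolute value.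
   Context: Setting. Let $b>0$, let $q:[0,b]\to\mathbb{C}$ be continuous, and let $f\in C^{2}[0,b]$ be a complex-valued solution of $f''-qf=0$ with $f(x)\neq 0$ on $[0,b]$ and $f(0)=1$. Put $h:=f'(0)\in\mathbb{C}$. $s(\omega,x;\infty)$ denotes the solution of $u''-q(x)u+\omega^2u=0$ with $s(\omega,0;\infty)=0$, $s'_x(\omega,0;\infty)=1$ ($\omega\in\mathbb{C}$). Recursive integrals: $X^{(0)}\equiv \widetilde X^{(0)}\equiv 1$ and, for $n\ge 1$, $X^{(n)}(x)=n\int_{0}^{x}X^{(n-1)}(s)(f^{2}(s))^{(-1)^{n}}ds$, $\widetilde X^{(n)}(x)=n\int_{0}^{x}\widetilde X^{(n-1)}(s)(f^{2}(s))^{(-1)^{n-1}}ds$. Put $\varphi_k=fX^{(k)}$ for $k$ odd and $\varphi_k=f\widetilde X^{(k)}$ for $k$ even. Define $\mathbf{c}_0(x)=f(x)$ and, for $m\ge 1$, $$\mathbf{c}_{m}(x)=\sum_{\substack{0\le k\le m\\ k\text{ even}}}\binom{m}{k}x^{k}\varphi_{m-k}(x),\qquad \mathbf{s}_{m}(x)=\sum_{\substack{1\le k\le m\\ k\text{ odd}}}\binom{m}{k}x^{k}\varphi_{m-k}(x).$$ Given coefficients $b_1,\dots,b_N$, the approximate solution is $$s_{N}(\omega ,x)=\frac{1}{\omega }\left( \sin \omega x+2\sum_{n=1}^{N}b_{n}\sum_{\substack{1\le k\le n\\ k\text{ odd}}}\binom{n}{k}\varphi_{n-k}(x)\int_{0}^{x}t^{k}\sin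 \omega t\,dt\right),$$ considered as an entire function of $\omega$ (the singularity at $\omega=0$ is removable). Zeros and multiplicities are taken with respect to the variable $\omega\in\mathbb{C}$. *)

theory Defs
  imports "HOL-Complex_Analysis.Complex_Analysis"
begin

text \<open>
  \<open>u\<close> is a \<open>C\<^sup>2\<close> solution on \<open>[0,b]\<close> of \<open>u'' - q u + \<lambda> u = 0\<close> with \<open>u(0) = c0\<close>, \<open>u'(0) = c1\<close>.
  Derivatives are taken within \<open>[0,b]\<close>, hence one-sided at the end points.
\<close>
definition ivp_solution ::
  "real \<Rightarrow> (real \<Rightarrow> complex) \<Rightarrow> complex \<Rightarrow> complex \<Rightarrow> complex \<Rightarrow> (real \<Rightarrow> complex) \<Rightarrow> bool" where
  "ivp_solution b q lam c0 c1 u \<longleftrightarrow>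
     (\<exists>u' u''. continuous_on {0..b} u'' \<and>
        (\<forall>x\<in>{0..b}.
           (u has_vector_derivative u' x) (at x within {0..b}) \<and>
           (u' has_vector_derivative u'' x) (at x within {0..b}) \<and>
           u'' x - q x * u x + lam * u x = 0) \<and>
        u 0 = c0 \<and> u' 0 = c1)"

primrec rec_X :: "(real \<Rightarrow> complex) \<Rightarrow> nat \<Rightarrow> real \<Rightarrow> complex" where
  "rec_X f 0 = (\<lambda>x. 1)"
| "rec_X f (Suc n) = (\<lambda>x. of_nat (Suc n) *
     integral {0..x} (\<lambda>t. rec_X f n t * ((f t)\<^sup>2) powi ((-1) ^ Suc n)))"

text \<open>In the equation for \<open>Suc n\<close> the exponent is \<open>(-1)^(Suc n - 1) = (-1)^n\<close>.\<close>
primrec rec_Xt :: "(real \<Rightarrow> complex) \<Rightarrow> nat \<Rightarrow> real \<Rightarrow> complex" where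
  "rec_Xt f 0 = (\<lambda>x. 1)"
| "rec_Xt f (Suc n) = (\<lambda>x. of_nat (Suc n) *
     integral {0..x} (\<lambda>t. rec_Xt f n t * ((f t)\<^sup>2) powi ((-1) ^ n)))"

definition phi :: "(real \<Rightarrow> complex) \<Rightarrow> nat \<Rightarrow> real \<Rightarrow> complex" where
  "phi f k x = f x * (if odd k then rec_X f k x else rec_Xt f k x)"

definition c_fun :: "(real \<Rightarrow> complex) \<Rightarrow> nat \<Rightarrow> real \<Rightarrow> complex" where
  "c_fun f m x =
     (if m = 0 then f x
      else (\<Sum>k | k \<le> m \<and> even k. of_nat (m choose k) * of_real x ^ k * phi f (m - k) x))"

definition s_fun :: "(real \<Rightarrow> complex) \<Rightarrow> nat \<Rightarrow> real \<Rightarrow> complex" where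
  "s_fun f m x =
     (\<Sum>k | 1 \<le> k \<and> k \<le> m \<and> odd k. of_nat (m choose k) * of_real x ^ k * phi f (m - k) x)"

text \<open>
  The approximate solution as an entire function of \<open>w\<close>: \<^const>\<open>remove_sings\<close> fills in the
  limit at the removable singularity \<open>w = 0\<close> and changes nothing elsewhere.
\<close>
definition s_approx ::
  "(real \<Rightarrow> complex) \<Rightarrow> nat \<Rightarrow> (nat \<Rightarrow> complex) \<Rightarrow> complex \<Rightarrow> real \<Rightarrow> complex" where
  "s_approx f N \<beta> w x = remove_sings (\<lambda>\<omega>. 1 / \<omega> *
     (sin (\<omega> * of_real x) +
      2 * (\<Sum>n = 1..N. \<beta> n *
        (\<Sum>k | 1 \<le> k \<and> k \<le> n \<and> odd k.
           of_nat (n choose k) * phi f (n - k) x *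
           integral {0..x} (\<lambda>t. of_real t ^ k * sin (\<omega> * of_real t)))))) w"

text \<open>
  The zeros of an entire function \<open>F\<close> (not identically zero), counted with multiplicity:
  a zero \<open>z\<close> of order \<open>m\<close> is represented by the \<open>m\<close> pairs \<open>(z,0), \<dots>, (z,m-1)\<close>.
\<close>
definition zeros_with_mult :: "(complex \<Rightarrow> complex) \<Rightarrow> (complex \<times> nat) set" where
  "zeros_with_mult F = {(z, j). F z = 0 \<and> int j < zorder F z}"

end

(*
  Put v(x) = \<omega> s_N(\<omega>, x) and J_k(x) = integral of t^k sin(\<omega> t) over [0,x]. From
  phi_k'' = q phi_k + k (k - 1) phi_{k-2} and the recurrence for J_k obtained by integrating by parts
  twice, v'' - q v + \<omega>^2 v = p'(x) sin(\<omega> x), where p = 4 (sum b_n s_n - 1/4 integral of q)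
  is uniformly small. In the variation-of-constants formula for v - \<omega> s the derivative p' (which
  need not be small) is integrated by parts onto sin(\<omega> (x - t)) sin(\<omega> t) / \<omega>, and
  Gronwall's inequality yields |\<omega>| |s_N - s| <= C \<epsilon>_2 exp(|Im \<omega>| b) with C independent
  of N and \<omega> for |\<omega>| >= 1; the maximum modulus principle covers |\<omega>| < 1.

  The same estimate gives \<omega> s(\<omega>, b) = sin(\<omega> b) + O(exp(|Im \<omega>| b) / |\<omega>|), and shows that the
  series with terms (-\<omega>^2)^k phi_{2k+1}(b) / (2k+1)! converges to s(\<omega>, b), which is
  therefore entire. Outside small discs around the points k pi / b with |k| large and around the
  finitely many remaining zeros, |\<omega> s(\<omega>, b)| is at least a constant times exp(|Im \<omega>| b), so
  Rouche's theorem in each disc matches the zeros.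
*)
theory Submission
  imports Defs
begin

section \<open>Forced linear equations: Gronwall, variation of constants, and a bound uniform in
  \<open>w\<close>\<close>

subsection \<open>Perturbation of the equation\<close>

lemma norm_sin_le_exp_Im: "norm (sin z) \<le> exp \<bar>Im z\<bar>" for z :: complex
proof -
  have "norm (sin z) = norm (exp (\<i> * z) - exp (- (\<i> * z))) / 2"
    by (simp add: sin_exp_eq norm_divide norm_mult)
  also have "\<dots> \<le> (norm (exp (\<i> * z)) + norm (exp (- (\<i> * z)))) / 2"
    by (intro divide_right_mono norm_triangle_ineq4) auto
  also have "\<dots> = (exp (- Im z) + exp (Im z)) / 2"
    by simp
  also have "\<dots> \<le> (exp \<bar>Im z\<bar> + exp \<bar>Im z\<bar>) / 2"
    by (intro divide_right_mono add_mono) auto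
  finally show ?thesis by simp
qed

text \<open>With F(t) = A + C * (integral of E over [0,t]), the function F(t) exp(-C t) has
  derivative C (E(t) - F(t)) exp(-C t), which is nonpositive by the hypothesis. It starts at A, so
  F(x) <= A exp(C x), and E <= F.\<close>

lemma gronwall:
  fixes E :: "real \<Rightarrow> real"
  assumes cont: "continuous_on {0..b} E" and C: "0 \<le> C"
    and le: "\<And>x. x \<in> {0..b} \<Longrightarrow> E x \<le> A + C * integral {0..x} E"
    and x: "x \<in> {0..b}"
  shows "E x \<le> A * exp (C * x)"
proof -
  define F where "F = (\<lambda>t. A + C * integral {0..t} E)"
  define G where "G = (\<lambda>t. F t * exp (- C * t))"
  have "(G has_vector_derivative (C * (E t - F t) * exp (- C * t))) (at t within {0..b})"
    if "t \<in> {0..b}" for t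
  proof -
    have "((\<lambda>u. integral {0..u} E) has_real_derivative E t) (at t within {0..b})"
      using integral_has_vector_derivative[OF cont that]
      by (simp add: has_real_derivative_iff_has_vector_derivative)
    then show ?thesis
      unfolding G_def F_def has_real_derivative_iff_has_vector_derivative[symmetric]
      by (auto intro!: derivative_eq_intros simp: algebra_simps)
  qed
  then have "((\<lambda>t. C * (E t - F t) * exp (- C * t)) has_integral (G x - G 0)) {0..x}"
    using x by (intro fundamental_theorem_of_calculus)
      (auto intro: has_vector_derivative_within_subset[of _ _ _ "{0..b}"])
  then have "G x - G 0 \<le> 0"
    by (rule has_integral_le[OF _ has_integral_0])
      (use x C le in \<open>auto simp: F_def mult_le_0_iff zero_le_mult_iff\<close>)
  then have "F x * exp (- C * x) \<le> A"
    by (simp add: G_def F_def)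
  then have "F x \<le> A * exp (C * x)"
    by (simp add: exp_minus field_simps)
  then show ?thesis
    using le[OF x] by (simp add: F_def)
qed

text \<open>Duhamel's formula with the \<open>p'\<close> term already integrated by parts. The
  t-derivative of sin(w (x - t)) sin(w t) / w is sin(w (x - 2 t)), and this product vanishes at t =
  0 and t = x, so no boundary term is left and only \<open>p\<close> itself enters. \<open>P\<close>
  is built so that P(x) = e(x) and P(0) = 0.\<close>

lemma variation_of_constants:
  fixes e e' p p' q g :: "real \<Rightarrow> complex" and w :: complex
  assumes w: "w \<noteq> 0"
    and e: "\<And>x. x \<in> {0..b} \<Longrightarrow> (e has_vector_derivative e' x) (at x within {0..b})"
    and e': "\<And>x. x \<in> {0..b} \<Longrightarrow>
      (e' has_vector_derivative q x * e x - w\<^sup>2 * e x + g x + p' x * sin (w * of_real x)) (at x within {0..b})"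
    and p: "\<And>x. x \<in> {0..b} \<Longrightarrow> (p has_vector_derivative p' x) (at x within {0..b})"
    and 0: "e 0 = 0" "e' 0 = 0" and x: "x \<in> {0..b}"
  shows "((\<lambda>t. sin (w * of_real (x - t)) / w * (q t * e t + g t) - p t * sin (w * of_real (x - 2 * t)))
    has_integral e x) {0..x}"
proof -
  define P where "P = (\<lambda>t. sin (w * of_real (x - t)) / w * (e' t - p t * sin (w * of_real t))
    + cos (w * of_real (x - t)) * e t)"
  let ?P' = "\<lambda>t. sin (w * of_real (x - t)) / w * (q t * e t + g t) - p t * sin (w * of_real (x - 2 * t))"
  have P': "(P has_vector_derivative ?P' t) (at t within {0..b})" if t: "t \<in> {0..b}" for t
  proof -
    have "((\<lambda>z. sin (w * (of_real x - z)) / w) has_field_derivative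
        - cos (w * (of_real x - of_real t))) (at (of_real t))"
      using w by (auto intro!: derivative_eq_intros)
    note s = has_vector_derivative_real_field[OF this, of "{0..b}"]
    have "((\<lambda>z. sin (w * z)) has_field_derivative w * cos (w * of_real t)) (at (of_real t))"
      by (auto intro!: derivative_eq_intros)
    note s1 = has_vector_derivative_real_field[OF this, of "{0..b}"]
    have "((\<lambda>z. cos (w * (of_real x - z))) has_field_derivative
        w * sin (w * (of_real x - of_real t))) (at (of_real t))"
      by (auto intro!: derivative_eq_intros)
    note c = has_vector_derivative_real_field[OF this, of "{0..b}"]
    have d: "sin (w * (of_real x - 2 * of_real t)) = sin (w * (of_real x - of_real t)) * cos (w * of_real t)
        - cos (w * (of_real x - of_real t)) * sin (w * of_real t)"
      by (subst sin_diff[symmetric]) (simp add: algebra_simps)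
    show ?thesis
      unfolding P_def of_real_diff of_real_mult of_real_numeral
      using has_vector_derivative_add[OF has_vector_derivative_mult[OF s
          has_vector_derivative_diff[OF e'[OF t] has_vector_derivative_mult[OF p[OF t] s1]]]
          has_vector_derivative_mult[OF c e[OF t]]]
      by (rule back_subst[where P = "\<lambda>d. (_ has_vector_derivative d) _"])
        (unfold d, insert w, simp add: field_simps power2_eq_square)
  qed
  have "(?P' has_integral (P x - P 0)) {0..x}"
    using x P' by (intro fundamental_theorem_of_calculus)
      (auto intro: has_vector_derivative_within_subset[of _ _ _ "{0..b}"])
  then show ?thesis
    by (simp add: P_def 0)
qed

text \<open>Weighting by exp(-|Im w| x) turns the Duhamel formula into a Gronwall inequality for
  \<open>E\<close>: the kernel sin(w (x - t)) costs exp(|Im w| (x - t)), and sin(w (x - 2 t)) costs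
  at most exp(|Im w| x) because |x - 2 t| <= x on [0,x]. Only the sup norm of \<open>p\<close>
  appears, never that of \<open>p'\<close>, which is what makes the later error bound independent of
  the number of terms.\<close>

lemma perturbation_bound:
  fixes e e' p p' q g :: "real \<Rightarrow> complex" and w :: complex
  assumes w: "1 \<le> norm w"
    and e: "\<And>x. x \<in> {0..b} \<Longrightarrow> (e has_vector_derivative e' x) (at x within {0..b})"
    and e': "\<And>x. x \<in> {0..b} \<Longrightarrow>
      (e' has_vector_derivative q x * e x - w\<^sup>2 * e x + g x + p' x * sin (w * of_real x)) (at x within {0..b})"
    and p: "\<And>x. x \<in> {0..b} \<Longrightarrow> (p has_vector_derivative p' x) (at x within {0..b})"
    and 0: "e 0 = 0" "e' 0 = 0" and x: "x \<in> {0..b}"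
    and q: "\<And>x. x \<in> {0..b} \<Longrightarrow> norm (q x) \<le> Q"
    and g: "\<And>x. x \<in> {0..b} \<Longrightarrow> norm (g x) \<le> G * exp (\<bar>Im w\<bar> * x)"
    and pB: "\<And>x. x \<in> {0..b} \<Longrightarrow> norm (p x) \<le> B"
  shows "norm (e x) \<le> (G / norm w + B) * b * exp (Q * b) * exp (\<bar>Im w\<bar> * x)"
proof -
  have b: "0 \<le> b" using x by auto
  have Q: "0 \<le> Q" and G: "0 \<le> G" and B: "0 \<le> B"
    using q[of 0] g[of 0] pB[of 0] b by (auto intro: order_trans[OF norm_ge_zero])
  have w0: "w \<noteq> 0" using w by auto
  define \<tau> where "\<tau> = \<bar>Im w\<bar>"
  define A where "A = G / norm w + B"
  define E where "E = (\<lambda>x. norm (e x) * exp (- \<tau> * x))"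
  have A: "0 \<le> A" using G B by (simp add: A_def)
  have ce: "continuous_on {0..b} e"
    using e by (meson continuous_on_eq_continuous_within has_vector_derivative_continuous)
  have cE: "continuous_on {0..b} E"
    unfolding E_def by (intro continuous_intros ce)
  have "E y \<le> A * b + Q * integral {0..y} E" if y: "y \<in> {0..b}" for y
  proof -
    let ?k = "\<lambda>t. sin (w * of_real (y - t)) / w * (q t * e t + g t) - p t * sin (w * of_real (y - 2 * t))"
    have cEy: "continuous_on {0..y} E"
      using cE y by (auto intro: continuous_on_subset)
    then have iE: "E integrable_on {0..y}"
      by (rule integrable_continuous_interval)
    have I: "(?k has_integral e y) {0..y}"
      by (rule variation_of_constants[OF w0 e e' p 0 y])
    have bd: "norm (?k t) \<le> (Q * E t + A) * exp (\<tau> * y)" if t: "t \<in> {0..y}" for t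
    proof -
      have tb: "t \<in> {0..b}" using t y by auto
      have "norm (sin (w * of_real (y - t))) \<le> exp (\<tau> * (y - t))"
        using norm_sin_le_exp_Im[of "w * of_real (y - t)"] t by (simp add: \<tau>_def abs_mult)
      then have s1: "norm (sin (w * of_real (y - t)) / w) \<le> exp (\<tau> * (y - t)) / norm w"
        by (simp add: norm_divide divide_right_mono)
      have "\<tau> * \<bar>y - 2 * t\<bar> \<le> \<tau> * y"
        using t by (intro mult_left_mono) (auto simp: \<tau>_def)
      then have s2: "norm (sin (w * of_real (y - 2 * t))) \<le> exp (\<tau> * y)"
        using norm_sin_le_exp_Im[of "w * of_real (y - 2 * t)"]
        by (simp add: \<tau>_def abs_mult) (smt (verit) exp_le_cancel_iff)
      have "norm (q t * e t + g t) \<le> Q * norm (e t) + G * exp (\<tau> * t)"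
        using q[OF tb] g[OF tb] unfolding \<tau>_def
        by (intro norm_triangle_le add_mono) (auto simp: norm_mult intro!: mult_right_mono)
      then have "norm (sin (w * of_real (y - t)) / w * (q t * e t + g t))
          \<le> exp (\<tau> * (y - t)) / norm w * (Q * norm (e t) + G * exp (\<tau> * t))"
        unfolding norm_mult by (intro mult_mono s1) auto
      also have "\<dots> = (Q * E t / norm w + G / norm w) * exp (\<tau> * y)"
        using w0 by (simp add: E_def field_simps exp_diff exp_minus)
      \<comment> \<open>Here \<open>1 \<le> norm w\<close> is used to drop the factor 1/|w| in front
        of Q, so that the Gronwall constant does not depend on w. The factor stays on G, where it
        yields the decay needed for the asymptotics.\<close>
      also have "\<dots> \<le> (Q * E t + G / norm w) * exp (\<tau> * y)"
      proof -
        have "Q * E t * 1 \<le> Q * E t * norm w"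
          using Q w by (intro mult_left_mono) (auto simp: E_def)
        then have "Q * E t / norm w \<le> Q * E t"
          using w0 by (simp add: field_simps)
        then show ?thesis by (intro mult_right_mono) auto
      qed
      finally have 1: "norm (sin (w * of_real (y - t)) / w * (q t * e t + g t))
          \<le> (Q * E t + G / norm w) * exp (\<tau> * y)" .
      have 2: "norm (p t * sin (w * of_real (y - 2 * t))) \<le> B * exp (\<tau> * y)"
        unfolding norm_mult using pB[OF tb] B by (intro mult_mono s2) auto
      have "norm (?k t) \<le> (Q * E t + G / norm w) * exp (\<tau> * y) + B * exp (\<tau> * y)"
        by (intro norm_triangle_le_diff add_mono 1 2)
      then show ?thesis by (simp add: A_def algebra_simps)
    qed
    have "norm (e y) \<le> integral {0..y} (\<lambda>t. (Q * E t + A) * exp (\<tau> * y))"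
      unfolding integral_unique[OF I, symmetric]
    proof (rule integral_norm_bound_integral[OF has_integral_integrable[OF I] _ bd])
      show "(\<lambda>t. (Q * E t + A) * exp (\<tau> * y)) integrable_on {0..y}"
        by (intro integrable_continuous_interval continuous_intros cEy)
    qed
    also have "\<dots> = integral {0..y} (\<lambda>t. Q * E t + A) * exp (\<tau> * y)"
      by simp
    also have "integral {0..y} (\<lambda>t. Q * E t + A) = Q * integral {0..y} E + A * y"
      using iE y by (subst integral_add) (auto intro: integrable_on_mult_right)
    finally have "E y \<le> Q * integral {0..y} E + A * y"
      by (simp add: E_def exp_minus field_simps)
    also have "A * y \<le> A * b"
      using A y by (intro mult_left_mono) auto
    finally show ?thesis by simp
  qed
  then have "E x \<le> A * b * exp (Q * x)"
    by (intro gronwall[OF cE Q _ x]) auto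
  also have "\<dots> \<le> A * b * exp (Q * b)"
    using A b x Q by (intro mult_left_mono) (auto intro: mult_left_mono)
  finally show ?thesis
    by (simp add: E_def A_def \<tau>_def exp_minus field_simps)
qed

section \<open>Lower bound for the sine, zero counting by Rouche's theorem, and matching of
  zeros\<close>

subsection \<open>Stability of zeros\<close>

text \<open>Factoring out the dominant exponential gives |sin z| = exp |Im z| * |exp w - 1| / 2. If
  exp w is within 1/2 of 1, then |Ln (exp w)| <= 2 |exp w - 1|, and Ln (exp w) differs from w by a
  multiple of 2 pi i, so its modulus is twice the distance from z to some multiple of pi.\<close>

lemma norm_sin_ge:
  fixes z :: complex
  assumes far: "\<And>k::int. \<rho> \<le> norm (z - of_int k * of_real pi)"
  shows "min (1/2) \<rho> / 2 * exp \<bar>Im z\<bar> \<le> norm (sin z)"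
proof -
  \<comment> \<open>This sign makes Re w = -2 |Im z|, so exp w is the small term in both half
    planes.\<close>
  define s :: complex where "s = (if 0 \<le> Im z then 1 else -1)"
  have s: "s = 1 \<or> s = -1" "norm s = 1" "s * Im z = \<bar>Im z\<bar>" "s * s = 1"
    by (auto simp: s_def)
  define w where "w = 2 * s * \<i> * z"
  have "sin z = s * (exp (- (s * \<i> * z)) * (exp w - 1)) / (2 * \<i>)"
    using s(1) by (auto simp: sin_exp_eq w_def algebra_simps exp_add[symmetric])
  then have sin: "norm (sin z) = exp \<bar>Im z\<bar> * norm (exp w - 1) / 2"
    using s by (auto simp: norm_mult norm_divide s_def)
  have "min (1/2) \<rho> \<le> norm (exp w - 1)"
  proof (cases "norm (exp w - 1) < 1/2")
    case True
    have "exp (Ln (exp w)) = exp w" by simp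
    from iffD1[OF exp_eq sym[OF this]] obtain n :: int
      where n: "w = Ln (exp w) + complex_of_real (of_int (2 * n) * pi) * \<i>"
      by blast
    have e: "1 + (exp w - 1) = exp w" by simp
    have "norm (w - complex_of_real (of_int (2 * n) * pi) * \<i>) = norm (Ln (1 + (exp w - 1)))"
      unfolding iffD2[OF diff_eq_eq n] e ..
    also have "\<dots> \<le> 2 * norm (exp w - 1)"
      by (rule norm_Ln_le[OF True])
    also have "w - complex_of_real (of_int (2 * n) * pi) * \<i> = 2 * s * \<i> * (z - of_int (if 0 \<le> Im z then n else - n) * of_real pi)"
      by (auto simp: w_def s_def algebra_simps)
    finally have "2 * norm (z - of_int (if 0 \<le> Im z then n else - n) * of_real pi) \<le> 2 * norm (exp w - 1)"
      unfolding norm_mult s(2) by simp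
    then show ?thesis
      using far[of "if 0 \<le> Im z then n else - n"] by linarith
  qed auto
  then have "exp \<bar>Im z\<bar> * min (1/2) \<rho> \<le> exp \<bar>Im z\<bar> * norm (exp w - 1)"
    by (intro mult_left_mono) auto
  then show ?thesis
    unfolding sin by (simp add: mult.commute)
qed

lemma finite_zeros_in_cball:
  assumes f: "f holomorphic_on UNIV" and z0: "f z0 \<noteq> 0"
  shows "finite {z \<in> cball c r. f z = 0}"
proof (cases "f constant_on UNIV")
  case True
  then have "f z \<noteq> 0" for z using z0 by (metis UNIV_I constant_on_def)
  then show ?thesis by simp
next
  case False
  then show ?thesis
    by (intro holomorphic_compact_finite_zeros[OF f]) auto
qed

text \<open>Ensures that converting the order to a natural number loses nothing, so the number of
  pairs over z in \<open>zeros_with_mult f\<close> is the order itself. The point \<open>z0\<close>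
  excludes the zero function, whose zeros are not isolated.\<close>

lemma zorder_nonneg_of_entire:
  assumes f: "f holomorphic_on UNIV" and z0: "f z0 \<noteq> 0"
  shows "0 \<le> zorder f z"
proof (rule zorder_ge_0)
  show "f analytic_on {z}"
    using f by (simp add: analytic_on_holomorphic) blast
  have "\<not> z islimpt {x \<in> cball z 1. f x = 0}"
    using finite_zeros_in_cball[OF f z0, of z 1] by (rule islimpt_finite)
  then have "eventually (\<lambda>x. x \<notin> {x \<in> cball z 1. f x = 0}) (at z)"
    by (simp add: islimpt_iff_eventually)
  moreover have "eventually (\<lambda>x. x \<in> ball z 1) (at z)"
    by (rule eventually_at_in_open') auto
  ultimately have "eventually (\<lambda>x. f x \<noteq> 0) (at z)"
    by eventually_elim auto
  then show "frequently (\<lambda>x. f x \<noteq> 0) (at z)"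
    by (intro eventually_frequently) auto
qed

lemma zeros_with_mult_ball:
  assumes f: "f holomorphic_on UNIV" and z0: "f z0 \<noteq> 0"
  shows "finite {p \<in> zeros_with_mult f. fst p \<in> ball c r}"
    and "int (card {p \<in> zeros_with_mult f. fst p \<in> ball c r}) = (\<Sum>z | z \<in> ball c r \<and> f z = 0. zorder f z)"
proof -
  let ?Z = "{z. z \<in> ball c r \<and> f z = 0}"
  have fin: "finite ?Z"
    by (rule finite_subset[OF _ finite_zeros_in_cball[OF f z0, of c r]]) auto
  have eq: "{p \<in> zeros_with_mult f. fst p \<in> ball c r} = (SIGMA z:?Z. {..<nat (zorder f z)})"
    by (auto simp: zeros_with_mult_def)
  show "finite {p \<in> zeros_with_mult f. fst p \<in> ball c r}"
    unfolding eq using fin by auto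
  show "int (card {p \<in> zeros_with_mult f. fst p \<in> ball c r}) = (\<Sum>z | z \<in> ball c r \<and> f z = 0. zorder f z)"
    unfolding eq using fin zorder_nonneg_of_entire[OF f z0] by (simp add: card_SigmaI)
qed

text \<open>The general Rouche theorem compares orders weighted by winding numbers; for a circle the
  weights are 1 inside and 0 outside. Since neither function vanishes on the circle, what remains is
  the sum of orders in the open disc, that is, the cardinality of the set of pairs.\<close>

lemma Rouche_ball:
  assumes f: "f holomorphic_on UNIV" and g: "g holomorphic_on UNIV" and r: "0 < r"
    and less: "\<And>z. z \<in> sphere c r \<Longrightarrow> norm (f z - g z) < norm (f z)"
  shows "card {p \<in> zeros_with_mult f. fst p \<in> ball c r} = card {p \<in> zeros_with_mult g. fst p \<in> ball c r}"
proof -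
  \<comment> \<open>A point of the circle where neither function vanishes; it certifies that both
    have only finitely many zeros in every disc.\<close>
  define z0 where "z0 = c + of_real r"
  have "z0 \<in> sphere c r" using r by (simp add: z0_def dist_norm)
  from less[OF this] have f0: "f z0 \<noteq> 0" and g0: "g z0 \<noteq> 0" by auto
  \<comment> \<open>The larger disc of radius r + 1 serves as the open connected domain containing
    the circle; the zeros it has beyond the closed disc of radius r get weight 0.\<close>
  have wsum: "(\<Sum>p | p \<in> ball c (r + 1) \<and> F p = 0. winding_number (circlepath c r) p * zorder F p)
      = of_int (\<Sum>p | p \<in> ball c r \<and> F p = 0. zorder F p)"
    if F: "F holomorphic_on UNIV" "\<And>z. z \<in> sphere c r \<Longrightarrow> F z \<noteq> 0" "F z0 \<noteq> 0" for F
  proof -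
    have "(\<Sum>p | p \<in> ball c (r + 1) \<and> F p = 0. winding_number (circlepath c r) p * zorder F p)
      = (\<Sum>p | p \<in> ball c r \<and> F p = 0. winding_number (circlepath c r) p * zorder F p)"
    proof (rule sum.mono_neutral_right)
      show "finite {p. p \<in> ball c (r + 1) \<and> F p = 0}"
        by (rule finite_subset[OF _ finite_zeros_in_cball[OF F(1,3), of c "r + 1"]]) auto
      show "\<forall>p\<in>{p. p \<in> ball c (r + 1) \<and> F p = 0} - {p. p \<in> ball c r \<and> F p = 0}.
          winding_number (circlepath c r) p * of_int (zorder F p) = 0"
      proof
        fix p assume "p \<in> {p. p \<in> ball c (r + 1) \<and> F p = 0} - {p. p \<in> ball c r \<and> F p = 0}"
        then have "p \<notin> cball c r"
          using F(2)[of p] by (auto simp: le_less)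
        then have "winding_number (circlepath c r) p = 0"
          using r by (intro winding_number_zero_outside[of _ "cball c r"]) auto
        then show "winding_number (circlepath c r) p * of_int (zorder F p) = 0" by simp
      qed
    qed auto
    also have "\<dots> = of_int (\<Sum>p | p \<in> ball c r \<and> F p = 0. zorder F p)"
      unfolding of_int_sum
      by (intro sum.cong refl) (auto simp: winding_number_circlepath dist_norm norm_minus_commute)
    finally show ?thesis .
  qed
  have "(\<Sum>p\<in>{p \<in> ball c (r + 1). f p + (g p - f p) = 0}. winding_number (circlepath c r) p * zorder (\<lambda>p. f p + (g p - f p)) p)
    = (\<Sum>p\<in>{p \<in> ball c (r + 1). f p = 0}. winding_number (circlepath c r) p * zorder f p)"
  proof (rule Rouche_theorem)
    show "finite {p \<in> ball c (r + 1). f p + (g p - f p) = 0}"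
      by (rule finite_subset[OF _ finite_zeros_in_cball[OF g g0, of c "r + 1"]]) auto
    show "finite {p \<in> ball c (r + 1). f p = 0}"
      by (rule finite_subset[OF _ finite_zeros_in_cball[OF f f0, of c "r + 1"]]) auto
    show "f holomorphic_on ball c (r + 1)" "(\<lambda>p. g p - f p) holomorphic_on ball c (r + 1)"
      by (auto intro!: holomorphic_intros holomorphic_on_subset[OF f] holomorphic_on_subset[OF g])
    show "\<forall>z\<in>path_image (circlepath c r). norm (g z - f z) < norm (f z)"
      using r less by (simp add: norm_minus_commute)
    show "\<forall>z. z \<notin> ball c (r + 1) \<longrightarrow> winding_number (circlepath c r) z = 0"
      using r by (auto intro!: winding_number_zero_outside[of _ "cball c r"])
  qed (use r in auto)
  then have "(of_int (\<Sum>p | p \<in> ball c r \<and> g p = 0. zorder g p) :: complex) = of_int (\<Sum>p | p \<in> ball c r \<and> f p = 0. zorder f p)"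
    using wsum[OF g _ g0] wsum[OF f _ f0] less by fastforce
  then have "(\<Sum>p | p \<in> ball c r \<and> g p = 0. zorder g p) = (\<Sum>p | p \<in> ball c r \<and> f p = 0. zorder f p)"
    by (simp only: of_int_eq_iff)
  then show ?thesis
    using zeros_with_mult_ball(2)[OF f f0, of c r] zeros_with_mult_ball(2)[OF g g0, of c r] by simp
qed

text \<open>Outside the discs neither function vanishes, and inside each disc Rouche gives equally
  many zeros. Bijections disc by disc are glued together; matched zeros share a disc of diameter at
  most \<open>\<epsilon>\<close>.\<close>

lemma zeros_matching:
  fixes f g :: "complex \<Rightarrow> complex" and r :: "complex \<Rightarrow> real"
  assumes f: "f holomorphic_on UNIV" and g: "g holomorphic_on UNIV"
    and r: "\<And>c. c \<in> C \<Longrightarrow> 0 < r c \<and> 2 * r c \<le> \<epsilon>"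
    and disj: "\<And>c c'. c \<in> C \<Longrightarrow> c' \<in> C \<Longrightarrow> c \<noteq> c' \<Longrightarrow> r c + r c' < dist c c'"
    and less: "\<And>z. (\<And>c. c \<in> C \<Longrightarrow> z \<notin> ball c (r c)) \<Longrightarrow> norm (f z - g z) < norm (f z)"
  shows "\<exists>h. bij_betw h (zeros_with_mult f) (zeros_with_mult g) \<and>
    (\<forall>p\<in>zeros_with_mult f. norm (fst (h p) - fst p) \<le> \<epsilon>)"
proof -
  define Z where "Z = (\<lambda>F c. {p \<in> zeros_with_mult F. fst p \<in> ball c (r c)})"
  \<comment> \<open>Disjointness is needed for the closed discs: each boundary circle must avoid all
    other discs so that \<open>less\<close> applies on it.\<close>
  have ball_unique: "c = c'" if "c \<in> C" "c' \<in> C" "z \<in> cball c (r c)" "z \<in> cball c' (r c')" for c c' z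
    using disj[of c c'] that dist_triangle2[of c c' z] by (fastforce simp: dist_commute)
  have "\<exists>h. bij_betw h (Z f c) (Z g c)" if c: "c \<in> C" for c
  proof -
    have sph: "norm (f z - g z) < norm (f z)" if z: "z \<in> sphere c (r c)" for z
    proof (rule less)
      fix c' assume c': "c' \<in> C"
      show "z \<notin> ball c' (r c')"
      proof
        assume "z \<in> ball c' (r c')"
        moreover from this have "c' = c"
          using z by (intro ball_unique[OF c' c, of z]) auto
        ultimately show False using z by auto
      qed
    qed
    have "c + of_real (r c) \<in> sphere c (r c)" using r[OF c] by (simp add: dist_norm)
    from sph[OF this] have "f (c + of_real (r c)) \<noteq> 0" "g (c + of_real (r c)) \<noteq> 0" by auto
    then have "finite (Z f c)" "finite (Z g c)"
      unfolding Z_def by (auto intro!: zeros_with_mult_ball(1) f g simp del: mem_ball)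
    moreover have "card (Z f c) = card (Z g c)"
      unfolding Z_def using r[OF c] by (intro Rouche_ball f g sph) auto
    ultimately show ?thesis
      by (rule finite_same_card_bij)
  qed
  then have "\<forall>c\<in>C. \<exists>h. bij_betw h (Z f c) (Z g c)" by blast
  from bchoice[OF this] obtain h where h: "\<And>c. c \<in> C \<Longrightarrow> bij_betw (h c) (Z f c) (Z g c)"
    by blast
  \<comment> \<open>The chosen centre is unique for every zero of \<open>f\<close>, so the choice
    merely looks up the disc containing it.\<close>
  define H where "H = (\<lambda>p. h (SOME c. c \<in> C \<and> fst p \<in> ball c (r c)) p)"
  have H: "H p = h c p" if "c \<in> C" "p \<in> Z f c" for c p
  proof -
    have "(SOME c. c \<in> C \<and> fst p \<in> ball c (r c)) = c"
    proof (rule some_equality)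
      show "c \<in> C \<and> fst p \<in> ball c (r c)"
        using that by (simp add: Z_def)
      show "c' = c" if "c' \<in> C \<and> fst p \<in> ball c' (r c')" for c'
        using that \<open>c \<in> C\<close> \<open>p \<in> Z f c\<close> by (intro ball_unique[of c' c "fst p"]) (auto simp: Z_def)
    qed
    then show ?thesis by (simp add: H_def)
  qed
  have bij: "bij_betw H (Z f c) (Z g c)" if "c \<in> C" for c
    using h[OF that] H[OF that] by (subst bij_betw_cong[of _ _ "h c"])
  have cover: "\<exists>c\<in>C. z \<in> ball c (r c)" if "f z = 0 \<or> g z = 0" for z
    using less[of z] that by fastforce
  have "c = c'" if "c \<in> C" "c' \<in> C" "p \<in> Z g c" "p \<in> Z g c'" for c c' p
    using that by (intro ball_unique[of c c' "fst p"]) (auto simp: Z_def)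
  then have "disjoint_family_on (Z g) C"
    unfolding disjoint_family_on_def by blast
  then have "bij_betw H (\<Union>c\<in>C. Z f c) (\<Union>c\<in>C. Z g c)"
    by (rule bij_betw_UNION_disjoint) (rule bij)
  moreover have "(\<Union>c\<in>C. Z f c) = zeros_with_mult f" "(\<Union>c\<in>C. Z g c) = zeros_with_mult g"
    using cover by (fastforce simp: Z_def zeros_with_mult_def)+
  moreover have "norm (fst (H p) - fst p) \<le> \<epsilon>" if p: "p \<in> zeros_with_mult f" for p
  proof -
    obtain c where c: "c \<in> C" "p \<in> Z f c"
      using calculation(2) p by blast
    then have "H p \<in> Z g c"
      using bij_betwE[OF bij] by blast
    then have "dist (fst (H p)) (fst p) \<le> \<epsilon>"
      using c r[OF c(1)] dist_triangle2[of "fst (H p)" "fst p" c] by (auto simp: Z_def dist_commute)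
    then show ?thesis by (simp add: dist_norm)
  qed
  ultimately show ?thesis by auto
qed

lemma pos_less_finite:
  fixes T :: "real set"
  assumes "finite T" "\<And>x. x \<in> T \<Longrightarrow> 0 < x"
  obtains s where "0 < s" "\<And>x. x \<in> T \<Longrightarrow> s < x"
proof
  let ?m = "Min (insert 1 T)"
  have "0 < ?m" using assms by simp
  then show "0 < ?m / 2" by simp
  show "?m / 2 < x" if "x \<in> T" for x
  proof -
    have "?m \<le> x" using assms(1) that by (intro Min_le) auto
    then show ?thesis using \<open>0 < ?m\<close> by linarith
  qed
qed

text \<open>The point is uniformity: \<open>\<delta>\<close> is fixed before \<open>\<Psi>\<close>
  and works for all of the infinitely many zeros. Far out, the error and the lower bound for |w
  Phi(w)| grow at the same rate exp(|Im w| b), so one relative tolerance suffices; the rest is a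
  compact region.\<close>

lemma sine_type_zeros_stable:
  fixes \<Phi> :: "complex \<Rightarrow> complex"
  assumes b: "0 < b" and hol: "\<Phi> holomorphic_on UNIV" and \<epsilon>: "0 < \<epsilon>"
    and asymp: "\<And>w. 1 \<le> norm w \<Longrightarrow>
      norm (w * \<Phi> w - sin (w * of_real b)) \<le> K / norm w * exp (\<bar>Im w\<bar> * b)"
  shows "\<exists>\<delta>>0. \<forall>\<Psi>. \<Psi> holomorphic_on UNIV \<longrightarrow>
    (\<forall>w. 1 \<le> norm w \<longrightarrow> norm (w * \<Psi> w - w * \<Phi> w) \<le> \<delta> * exp (\<bar>Im w\<bar> * b)) \<longrightarrow>
    (\<exists>h. bij_betw h (zeros_with_mult \<Phi>) (zeros_with_mult \<Psi>) \<and>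
      (\<forall>p\<in>zeros_with_mult \<Phi>. norm (fst (h p) - fst p) \<le> \<epsilon>))"
proof -
  \<comment> \<open>The zeros of sin(w b) are the points \<open>P k\<close>, with spacing
    \<open>d\<close>. The bound eps/2 on \<open>\<rho>\<close> limits the disc diameters, the bound
    d/4 separates the discs, and \<open>m\<close> is the constant of \<open>norm_sin_ge\<close> at z
    = w b.\<close>
  define d where "d = pi / b"
  define \<rho> where "\<rho> = min (\<epsilon> / 2) (d / 4)"
  define m where "m = min (1/2) (\<rho> * b) / 2"
  have d: "0 < d" using b by (simp add: d_def)
  have \<rho>: "0 < \<rho>" "2 * \<rho> \<le> \<epsilon>" "\<rho> \<le> d / 4" using d \<epsilon> by (auto simp: \<rho>_def)
  have m: "0 < m" using \<rho> b by (simp add: m_def)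
  define P where "P = (\<lambda>k::int. complex_of_real (of_int k * d))"
  have sin_ge: "m * exp (\<bar>Im w\<bar> * b) \<le> norm (sin (w * of_real b))"
    if "\<And>k. \<rho> \<le> norm (w - P k)" for w
  proof -
    have "\<rho> * b \<le> norm (w * of_real b - of_int k * of_real pi)" for k
    proof -
      have "w * of_real b - of_int k * of_real pi = (w - P k) * of_real b"
        using b by (simp add: P_def d_def algebra_simps)
      then show ?thesis
        using that[of k] b by (simp add: norm_mult mult_right_mono)
    qed
    from norm_sin_ge[OF this] show ?thesis
      using b by (simp add: m_def abs_mult)
  qed
  \<comment> \<open>With this k0 the radius R is at least 1, and K/|w| <= m/2 for |w| >= R, so the
    remainder takes at most half of the lower bound for the sine. The half step in R puts the circle
    |w| = R at distance at least d/2 from every \<open>P k\<close>.\<close>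
  obtain k0 :: nat where k0: "max 1 (2 * K / m) / d < of_nat k0"
    using reals_Archimedean2 by blast
  define R where "R = (of_nat k0 + 1/2) * d"
  have "max 1 (2 * K / m) < of_nat k0 * d"
    using k0 d by (simp add: field_simps)
  then have R: "1 \<le> R" "2 * K / m \<le> R"
    using d by (auto simp: R_def algebra_simps)
  have norm_P: "norm (P k) = of_int \<bar>k\<bar> * d" for k
    using d unfolding P_def norm_of_real by (simp add: abs_mult)
  have lower: "m / 2 * exp (\<bar>Im w\<bar> * b) \<le> norm (w * \<Phi> w)"
    if w: "R \<le> norm w" and far: "\<And>k. \<rho> \<le> norm (w - P k)" for w
  proof -
    have "2 * K / m \<le> norm w" using R w by linarith
    moreover have "0 < norm w" using R w by linarith
    ultimately have "K / norm w \<le> m / 2"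
      using m by (simp add: field_simps)
    then have "K / norm w * exp (\<bar>Im w\<bar> * b) \<le> m / 2 * exp (\<bar>Im w\<bar> * b)"
      by (intro mult_right_mono) auto
    moreover have "norm (w * \<Phi> w - sin (w * of_real b)) \<le> K / norm w * exp (\<bar>Im w\<bar> * b)"
      using R w by (intro asymp) linarith
    moreover have "norm (sin (w * of_real b)) - norm (w * \<Phi> w) \<le> norm (w * \<Phi> w - sin (w * of_real b))"
      using norm_triangle_ineq2[of "sin (w * of_real b)" "w * \<Phi> w"] by (simp only: norm_minus_commute)
    moreover have "m * exp (\<bar>Im w\<bar> * b) = m / 2 * exp (\<bar>Im w\<bar> * b) + m / 2 * exp (\<bar>Im w\<bar> * b)"
      by simp
    ultimately show ?thesis
      using sin_ge[OF far] by linarith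
  qed
  have far_inner: "\<rho> \<le> norm (w - P k)" if "R \<le> norm w" "\<bar>k\<bar> \<le> int k0" for w k
  proof -
    have "of_int \<bar>k\<bar> * d \<le> of_nat k0 * d"
      using that d by (intro mult_right_mono) linarith+
    moreover have "R = of_nat k0 * d + d / 2" by (simp add: R_def algebra_simps)
    ultimately show ?thesis
      using that(1) norm_triangle_ineq2[of w "P k"] norm_P[of k] \<rho> d by linarith
  qed
  have P_outer: "R + d / 2 \<le> norm (P k)" if "int k0 < \<bar>k\<bar>" for k
  proof -
    have "(of_nat k0 + 1) * d \<le> of_int \<bar>k\<bar> * d"
      using that d by (intro mult_right_mono) linarith+
    moreover have "(of_nat k0 + 1) * d = R + d / 2" by (simp add: R_def algebra_simps)
    ultimately show ?thesis by (simp only: norm_P)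
  qed
  have nz_sphere: "\<Phi> w \<noteq> 0" if "norm w = R" for w
  proof -
    have far: "\<rho> \<le> norm (w - P k)" for k
    proof (cases "\<bar>k\<bar> \<le> int k0")
      case True
      then show ?thesis using far_inner[of w k] that by simp
    next
      case False
      then show ?thesis
        using P_outer[of k] norm_triangle_ineq2[of "P k" w] that \<rho> d by (simp add: norm_minus_commute)
    qed
    have "m / 2 * exp (\<bar>Im w\<bar> * b) \<le> norm (w * \<Phi> w)"
      by (rule lower[OF _ far]) (simp add: that)
    moreover have "0 < m / 2 * exp (\<bar>Im w\<bar> * b)"
      using m by simp
    ultimately show ?thesis by force
  qed
  define Z0 where "Z0 = {z \<in> cball 0 R. \<Phi> z = 0}"
  have fin: "finite Z0"
    unfolding Z0_def using nz_sphere[of "of_real R"] R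
    by (intro finite_zeros_in_cball[OF hol]) auto
  have Z0_inner: "norm z < R" if "z \<in> Z0" for z
    using that nz_sphere[of z] by (auto simp: Z0_def le_less)
  \<comment> \<open>One radius for the finitely many inner zeros, small enough that their discs stay
    inside |w| < R and are pairwise disjoint.\<close>
  obtain \<sigma> where \<sigma>: "0 < \<sigma>" "\<sigma> < \<rho>" "\<And>z. z \<in> Z0 \<Longrightarrow> \<sigma> < R - norm z"
    "\<And>z z'. z \<in> Z0 \<Longrightarrow> z' \<in> Z0 \<Longrightarrow> z \<noteq> z' \<Longrightarrow> \<sigma> < dist z z' / 2"
  proof -
    let ?T = "insert \<rho> ((\<lambda>z. R - norm z) ` Z0 \<union> (\<lambda>(z, z'). dist z z' / 2) ` {(z, z') \<in> Z0 \<times> Z0. z \<noteq> z'})"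
    have "finite ?T"
      using fin by (auto intro: finite_subset[of _ "Z0 \<times> Z0"])
    moreover have "0 < x" if "x \<in> ?T" for x
      using that \<rho> Z0_inner by auto
    ultimately obtain s where s: "0 < s" "\<And>x. x \<in> ?T \<Longrightarrow> s < x"
      by (rule pos_less_finite) auto
    show ?thesis
    proof (rule that[of s])
      show "s < dist z z' / 2" if "z \<in> Z0" "z' \<in> Z0" "z \<noteq> z'" for z z'
      proof -
        have "(\<lambda>(z, z'). dist z z' / 2) (z, z') \<in> ?T" using that by blast
        from s(2)[OF this] show ?thesis by simp
      qed
    qed (use s in blast)+
  qed
  define r where "r = (\<lambda>c. if c \<in> Z0 then \<sigma> else \<rho>)"
  \<comment> \<open>Inner discs are centred at the true zeros of \<open>\<Phi>\<close>, outer ones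
    at the zeros of the sine; the outer centres have modulus at least R + d/2, so the two kinds of
    disc do not meet.\<close>
  define C where "C = Z0 \<union> P ` {k. int k0 < \<bar>k\<bar>}"
  have r_P: "r (P k) = \<rho>" if "int k0 < \<bar>k\<bar>" for k
    using P_outer[OF that] Z0_inner[of "P k"] d by (auto simp: r_def)
  have mixed: "r z + r (P k) < dist z (P k)" if z: "z \<in> Z0" and k: "int k0 < \<bar>k\<bar>" for z k
    using \<sigma>(3)[OF z] P_outer[OF k] norm_triangle_ineq2[of "P k" z] z \<rho> d
    by (simp add: r_P[OF k]) (simp add: r_def dist_norm norm_minus_commute)
  have disj: "r c + r c' < dist c c'" if c: "c \<in> C" "c' \<in> C" "c \<noteq> c'" for c c'
  proof -
    have outer: "r (P k) + r (P l) < dist (P k) (P l)"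
      if kl: "int k0 < \<bar>k\<bar>" "int k0 < \<bar>l\<bar>" "P k \<noteq> P l" for k l
    proof -
      have "k \<noteq> l" using kl by auto
      then have "1 * d \<le> of_int \<bar>k - l\<bar> * d"
        using d by (intro mult_right_mono) linarith+
      moreover have "dist (P k) (P l) = of_int \<bar>k - l\<bar> * d"
        using norm_P[of "k - l"] by (simp add: dist_norm P_def algebra_simps)
      ultimately show ?thesis
        using r_P[OF kl(1)] r_P[OF kl(2)] \<rho> d by linarith
    qed
    show ?thesis
    proof (cases "c \<in> Z0"; cases "c' \<in> Z0")
      assume "c \<in> Z0" "c' \<in> Z0"
      then show ?thesis using \<sigma>(4)[of c c'] c(3) by (simp add: r_def)
    next
      assume "c \<in> Z0" "c' \<notin> Z0"
      then show ?thesis using c(2) mixed by (auto simp: C_def)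
    next
      assume "c \<notin> Z0" "c' \<in> Z0"
      then show ?thesis
        using c(1) mixed[of c'] unfolding dist_commute[of c] add.commute[of "r c"] by (auto simp: C_def)
    next
      assume "c \<notin> Z0" "c' \<notin> Z0"
      then show ?thesis using c outer by (auto simp: C_def)
    qed
  qed
  \<comment> \<open>A compact set without zeros of \<open>\<Phi>\<close>, hence with a positive
    minimum of its modulus; if it is empty, any positive value of \<open>m2\<close> will do.\<close>
  define I where "I = cball 0 R - (\<Union>z\<in>Z0. ball z \<sigma>)"
  have "\<exists>m2>0. \<forall>w\<in>I. m2 \<le> norm (\<Phi> w)"
  proof (cases "I = {}")
    case False
    have "compact I"
      unfolding I_def by (intro compact_diff) auto
    moreover have "continuous_on I (\<lambda>w. norm (\<Phi> w))"
      using holomorphic_on_imp_continuous_on[OF hol] by (intro continuous_on_norm) (auto intro: continuous_on_subset)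
    ultimately obtain w0 where w0: "w0 \<in> I" "\<And>w. w \<in> I \<Longrightarrow> norm (\<Phi> w0) \<le> norm (\<Phi> w)"
      using continuous_attains_inf[of I "\<lambda>w. norm (\<Phi> w)"] False by auto
    have "\<Phi> w0 \<noteq> 0"
      using w0(1) \<sigma>(1) by (force simp: I_def Z0_def)
    then show ?thesis
      using w0(2) by (intro exI[of _ "norm (\<Phi> w0)"]) auto
  qed (auto intro: exI[of _ 1])
  then obtain m2 where m2: "0 < m2" "\<And>w. w \<in> I \<Longrightarrow> m2 \<le> norm (\<Phi> w)" by auto
  \<comment> \<open>The first entry keeps the error strictly below m/2 * exp(|Im w| b) in the outer
    region. The second makes the difference at most m2/2 on |w| = R.\<close>
  define \<delta> where "\<delta> = min (m / 4) (m2 * R / (2 * exp (R * b)))"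
  have \<delta>: "0 < \<delta>" "\<delta> \<le> m / 4" "\<delta> * exp (R * b) \<le> m2 * R / 2"
  proof -
    show "0 < \<delta>" "\<delta> \<le> m / 4" using m m2 R by (auto simp: \<delta>_def)
    have "\<delta> * exp (R * b) \<le> m2 * R / (2 * exp (R * b)) * exp (R * b)"
      by (intro mult_right_mono) (auto simp: \<delta>_def)
    then show "\<delta> * exp (R * b) \<le> m2 * R / 2" by simp
  qed
  show ?thesis
  proof (intro exI[of _ \<delta>] conjI \<delta>(1) allI impI)
    fix \<Psi> assume \<Psi>: "\<Psi> holomorphic_on UNIV"
      and close: "\<forall>w. 1 \<le> norm w \<longrightarrow> norm (w * \<Psi> w - w * \<Phi> w) \<le> \<delta> * exp (\<bar>Im w\<bar> * b)"
    show "\<exists>h. bij_betw h (zeros_with_mult \<Phi>) (zeros_with_mult \<Psi>) \<and>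
      (\<forall>p\<in>zeros_with_mult \<Phi>. norm (fst (h p) - fst p) \<le> \<epsilon>)"
    proof (rule zeros_matching[OF hol \<Psi> _ disj])
      show "0 < r c \<and> 2 * r c \<le> \<epsilon>" for c
        using \<sigma> \<rho> by (auto simp: r_def)
      fix w assume out: "\<And>c. c \<in> C \<Longrightarrow> w \<notin> ball c (r c)"
      show "norm (\<Phi> w - \<Psi> w) < norm (\<Phi> w)"
      proof (cases "R \<le> norm w")
        case True
        have "\<rho> \<le> norm (w - P k)" for k
        proof (cases "\<bar>k\<bar> \<le> int k0")
          case True
          then show ?thesis using far_inner \<open>R \<le> norm w\<close> by blast
        next
          case False
          then show ?thesis
            using out[of "P k"] r_P[of k] by (auto simp: C_def dist_norm norm_minus_commute)
        qed
        then have "m / 2 * exp (\<bar>Im w\<bar> * b) \<le> norm (w * \<Phi> w)"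
          by (rule lower[OF True])
        moreover have "norm (w * \<Psi> w - w * \<Phi> w) \<le> \<delta> * exp (\<bar>Im w\<bar> * b)"
          using close True R by auto
        moreover have "\<delta> * exp (\<bar>Im w\<bar> * b) < m / 2 * exp (\<bar>Im w\<bar> * b)"
          using \<delta> m by (intro mult_strict_right_mono) auto
        ultimately have "norm (w * \<Psi> w - w * \<Phi> w) < norm (w * \<Phi> w)"
          by linarith
        then have "norm w * norm (\<Psi> w - \<Phi> w) < norm w * norm (\<Phi> w)"
          by (simp only: norm_mult[symmetric] right_diff_distrib)
        moreover have "0 < norm w" using True R by linarith
        ultimately show ?thesis
          by (simp add: norm_minus_commute)
      next
        case False
        \<comment> \<open>The hypothesis says nothing for |w| < 1, and multiplication by w would
          lose control near 0; the bound is therefore carried inwards from the circle |w| = R by the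
          maximum modulus principle.\<close>
        have "norm (\<Psi> w - \<Phi> w) \<le> m2 / 2"
        proof (rule maximum_modulus_frontier[of "\<lambda>w. \<Psi> w - \<Phi> w" "cball 0 R"])
          show "(\<lambda>w. \<Psi> w - \<Phi> w) holomorphic_on interior (cball 0 R)"
            by (intro holomorphic_intros holomorphic_on_subset[OF hol] holomorphic_on_subset[OF \<Psi>]) auto
          show "continuous_on (closure (cball 0 R)) (\<lambda>w. \<Psi> w - \<Phi> w)"
            by (intro holomorphic_on_imp_continuous_on holomorphic_intros
                holomorphic_on_subset[OF hol] holomorphic_on_subset[OF \<Psi>]) auto
          fix z :: complex assume "z \<in> frontier (cball 0 R)"
          then have z: "norm z = R" using R by auto
          have "R * norm (\<Psi> z - \<Phi> z) = norm (z * \<Psi> z - z * \<Phi> z)"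
            by (simp add: z[symmetric] norm_mult[symmetric] right_diff_distrib)
          also have "\<dots> \<le> \<delta> * exp (\<bar>Im z\<bar> * b)"
            using close z R by auto
          also have "\<dots> \<le> \<delta> * exp (R * b)"
            using \<delta> b abs_Im_le_cmod[of z] z by (intro mult_left_mono) auto
          also have "\<dots> \<le> m2 * R / 2" by (rule \<delta>(3))
          finally show "norm (\<Psi> z - \<Phi> z) \<le> m2 / 2"
            using R by (simp add: field_simps)
        qed (use False in auto)
        moreover have "w \<notin> ball z \<sigma>" if "z \<in> Z0" for z
          using out[of z] that by (simp add: C_def r_def)
        then have "w \<in> I"
          using False by (simp add: I_def)
        ultimately show ?thesis
          using m2(1) m2(2)[of w] by (simp add: norm_minus_commute)
      qed
    qed
  qed
qed

section \<open>The formal powers, their differential equation, and the series of s(w, b) in powers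
  of w^2\<close>

subsection \<open>Formal powers\<close>

text \<open>A common frame for both families X and X~, with \<open>r n\<close> the alternating
  weight. In the bound, the factor n + 1 of the recursion cancels the 1/(n + 1) from integrating
  t^n, so no factorial arises.\<close>

lemma iterated_integrals:
  fixes Y r :: "nat \<Rightarrow> real \<Rightarrow> complex"
  assumes Y0: "\<And>x. Y 0 x = 1"
    and YS: "\<And>n x. Y (Suc n) x = of_nat (Suc n) * integral {0..x} (\<lambda>t. Y n t * r n t)"
    and r: "\<And>n. continuous_on {0..b} (r n)"
    and M: "\<And>n t. t \<in> {0..b} \<Longrightarrow> norm (r n t) \<le> M"
  shows iterated_integrals_continuous: "continuous_on {0..b} (Y n)"
    and iterated_integrals_deriv: "x \<in> {0..b} \<Longrightarrow>
      (Y (Suc n) has_vector_derivative of_nat (Suc n) * (Y n x * r n x)) (at x within {0..b})"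
    and iterated_integrals_bound: "x \<in> {0..b} \<Longrightarrow> norm (Y n x) \<le> (M * x) ^ n"
proof -
  have step: "(Y (Suc n) has_vector_derivative of_nat (Suc n) * (Y n x * r n x)) (at x within {0..b})"
    if "continuous_on {0..b} (Y n)" "x \<in> {0..b}" for n x
    unfolding YS
    by (intro has_vector_derivative_mult_right integral_has_vector_derivative continuous_intros r that)
  have cont: "continuous_on {0..b} (Y n)" for n
  proof (induction n)
    case 0
    have "Y 0 = (\<lambda>x. 1)" by (auto simp: Y0)
    then show ?case by simp
  next
    case (Suc n)
    then show ?case
      using step[OF Suc] by (meson continuous_on_eq_continuous_within has_vector_derivative_continuous)
  qed
  show "continuous_on {0..b} (Y n)" by (rule cont)
  show "x \<in> {0..b} \<Longrightarrow>
      (Y (Suc n) has_vector_derivative of_nat (Suc n) * (Y n x * r n x)) (at x within {0..b})"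
    by (rule step[OF cont])
  show "x \<in> {0..b} \<Longrightarrow> norm (Y n x) \<le> (M * x) ^ n"
  proof (induction n arbitrary: x)
    case 0
    then show ?case by (simp add: Y0)
  next
    case (Suc n)
    have M0: "0 \<le> M"
      using M[OF Suc.prems, of 0] by (rule order_trans[OF norm_ge_zero])
    have int: "((\<lambda>t. (M * t) ^ n * M) has_integral (M * x) ^ Suc n / of_nat (Suc n) - (M * 0) ^ Suc n / of_nat (Suc n)) {0..x}"
    proof (intro fundamental_theorem_of_calculus)
      show "((\<lambda>t. (M * t) ^ Suc n / of_nat (Suc n)) has_vector_derivative (M * t) ^ n * M) (at t within {0..x})" for t
        unfolding has_real_derivative_iff_has_vector_derivative[symmetric]
        by (rule derivative_eq_intros refl | simp del: of_nat_Suc)+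
    qed (use Suc.prems in auto)
    have "norm (integral {0..x} (\<lambda>t. Y n t * r n t)) \<le> integral {0..x} (\<lambda>t. (M * t) ^ n * M)"
    proof (rule integral_norm_bound_integral)
      show "(\<lambda>t. Y n t * r n t) integrable_on {0..x}"
        by (rule integrable_continuous_interval, rule continuous_on_subset[of "{0..b}"])
          (use Suc.prems in \<open>auto intro!: continuous_intros cont r\<close>)
      show "norm (Y n t * r n t) \<le> (M * t) ^ n * M" if "t \<in> {0..x}" for t
        unfolding norm_mult using that Suc.prems M0 by (intro mult_mono Suc.IH M) auto
    qed (use int in auto)
    also have "\<dots> = (M * x) ^ Suc n / of_nat (Suc n)"
      using integral_unique[OF int] by simp
    finally show ?case
      by (simp add: YS norm_mult field_simps del: of_nat_Suc power_Suc)
  qed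
qed

lemma ivp_solutionE:
  assumes "ivp_solution b q lam c0 c1 u"
  obtains u' where "\<And>x. x \<in> {0..b} \<Longrightarrow> (u has_vector_derivative u' x) (at x within {0..b})"
    "\<And>x. x \<in> {0..b} \<Longrightarrow> (u' has_vector_derivative q x * u x - lam * u x) (at x within {0..b})"
    "u 0 = c0" "u' 0 = c1"
proof -
  obtain u' u'' where u: "\<forall>x\<in>{0..b}. (u has_vector_derivative u' x) (at x within {0..b}) \<and>
      (u' has_vector_derivative u'' x) (at x within {0..b}) \<and> u'' x - q x * u x + lam * u x = 0"
      "u 0 = c0" "u' 0 = c1"
    using assms unfolding ivp_solution_def by blast
  have eq: "u'' x = q x * u x - lam * u x" if "x \<in> {0..b}" for x
    using bspec[OF u(1) that] by (simp add: algebra_simps eq_diff_eq)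
  show ?thesis
    by (rule that[of u']) (use u eq in force)+
qed

locale nonvanishing_solution =
  fixes b :: real and q f f' :: "real \<Rightarrow> complex"
  assumes b_pos: "0 < b"
    and q_cont: "continuous_on {0..b} q"
    and f_deriv: "\<And>x. x \<in> {0..b} \<Longrightarrow> (f has_vector_derivative f' x) (at x within {0..b})"
    and f'_deriv: "\<And>x. x \<in> {0..b} \<Longrightarrow> (f' has_vector_derivative q x * f x) (at x within {0..b})"
    and f_nz: "\<And>x. x \<in> {0..b} \<Longrightarrow> f x \<noteq> 0"
    and f_0: "f 0 = 1"
begin

lemma f_cont: "continuous_on {0..b} f"
  using f_deriv by (meson continuous_on_eq_continuous_within has_vector_derivative_continuous)

lemma weight_cont: "continuous_on {0..b} (\<lambda>t. ((f t)\<^sup>2) powi k)"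
  by (intro continuous_intros f_cont) (use f_nz in auto)

text \<open>Only the exponents 1 and -1 occur, so one constant bounds f^2 and 1/f^2 on the whole
  interval; it exists by compactness, since f is continuous without zeros.\<close>

definition weight_bound :: real where
  "weight_bound = (SOME M. \<forall>t\<in>{0..b}. \<forall>n::nat. norm (((f t)\<^sup>2) powi ((-1) ^ n)) \<le> M)"

lemma weight_bound:
  assumes "t \<in> {0..b}"
  shows "norm (((f t)\<^sup>2) powi ((-1) ^ n)) \<le> weight_bound"
proof -
  have "\<exists>M. \<forall>t\<in>{0..b}. norm (((f t)\<^sup>2) powi k) \<le> M" for k
    using compact_imp_bounded[OF compact_continuous_image[OF weight_cont[of k] compact_Icc]]
    by (auto simp: bounded_iff)
  then obtain M where M: "\<And>k t. t \<in> {0..b} \<Longrightarrow> norm (((f t)\<^sup>2) powi k) \<le> M k"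
    by metis
  have "\<forall>t\<in>{0..b}. \<forall>n::nat. norm (((f t)\<^sup>2) powi ((-1) ^ n)) \<le> max (M 1) (M (-1))"
  proof (intro ballI allI)
    fix t n assume "t \<in> {0..b}"
    then show "norm (((f t)\<^sup>2) powi ((-1) ^ n)) \<le> max (M 1) (M (-1))"
      using M[of t 1] M[of t "-1"] by (cases "even n") auto
  qed
  then have "\<exists>M. \<forall>t\<in>{0..b}. \<forall>n::nat. norm (((f t)\<^sup>2) powi ((-1) ^ n)) \<le> M"
    by blast
  from someI_ex[OF this] show ?thesis
    using assms unfolding weight_bound_def by blast
qed

lemma rec_X_deriv:
  assumes "x \<in> {0..b}"
  shows "even n \<Longrightarrow> (rec_X f (Suc n) has_vector_derivative
      of_nat (Suc n) * (rec_X f n x / (f x)\<^sup>2)) (at x within {0..b})"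
    and "odd n \<Longrightarrow> (rec_X f (Suc n) has_vector_derivative
      of_nat (Suc n) * rec_X f n x * (f x)\<^sup>2) (at x within {0..b})"
proof -
  have "(rec_X f (Suc n) has_vector_derivative
      of_nat (Suc n) * (rec_X f n x * ((f x)\<^sup>2) powi ((-1) ^ Suc n))) (at x within {0..b})"
    by (rule iterated_integrals_deriv[OF _ _ weight_cont weight_bound assms]) auto
  then show "even n \<Longrightarrow> (rec_X f (Suc n) has_vector_derivative
      of_nat (Suc n) * (rec_X f n x / (f x)\<^sup>2)) (at x within {0..b})"
    and "odd n \<Longrightarrow> (rec_X f (Suc n) has_vector_derivative
      of_nat (Suc n) * rec_X f n x * (f x)\<^sup>2) (at x within {0..b})"
    by (simp_all add: power_int_minus divide_inverse mult.assoc del: rec_X.simps of_nat_Suc)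
qed

lemma rec_Xt_deriv:
  assumes "x \<in> {0..b}"
  shows "odd n \<Longrightarrow> (rec_Xt f (Suc n) has_vector_derivative
      of_nat (Suc n) * (rec_Xt f n x / (f x)\<^sup>2)) (at x within {0..b})"
    and "even n \<Longrightarrow> (rec_Xt f (Suc n) has_vector_derivative
      of_nat (Suc n) * rec_Xt f n x * (f x)\<^sup>2) (at x within {0..b})"
proof -
  have "(rec_Xt f (Suc n) has_vector_derivative
      of_nat (Suc n) * (rec_Xt f n x * ((f x)\<^sup>2) powi ((-1) ^ n))) (at x within {0..b})"
    by (rule iterated_integrals_deriv[OF _ _ weight_cont weight_bound assms]) auto
  then show "odd n \<Longrightarrow> (rec_Xt f (Suc n) has_vector_derivative
      of_nat (Suc n) * (rec_Xt f n x / (f x)\<^sup>2)) (at x within {0..b})"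
    and "even n \<Longrightarrow> (rec_Xt f (Suc n) has_vector_derivative
      of_nat (Suc n) * rec_Xt f n x * (f x)\<^sup>2) (at x within {0..b})"
    by (simp_all add: power_int_minus divide_inverse mult.assoc del: rec_Xt.simps of_nat_Suc)
qed

lemma rec_X_bound: "x \<in> {0..b} \<Longrightarrow> norm (rec_X f n x) \<le> (weight_bound * x) ^ n"
  by (rule iterated_integrals_bound[where b = b and r = "\<lambda>n t. ((f t)\<^sup>2) powi ((-1) ^ Suc n)"])
    (auto simp only: rec_X.simps intro!: weight_cont weight_bound)

text \<open>The derivative of \<open>phi f k\<close>. The second term comes from f times the
  derivative of the recursive integral, which carries the weight 1/f^2 in the family selected by the
  parity of k. It stays in that family and is thus not a multiple of \<open>phi f (k - 1)\<close>.
  At k = 0 the truncated index is killed by the factor k.\<close>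

definition phi' :: "nat \<Rightarrow> real \<Rightarrow> complex" where
  "phi' k x = f' x * (if odd k then rec_X f k x else rec_Xt f k x)
     + of_nat k * (if odd k then rec_X f (k - 1) x else rec_Xt f (k - 1) x) / f x"

text \<open>The factorization D^2 - q = (D + f'/f)(D - f'/f), valid because q = f''/f. The right
  factor maps f Y to f Y' = k W / f, and the left factor maps k W / f to k W' / f.\<close>

lemma darboux_step:
  assumes x: "x \<in> {0..b}"
    and Y: "(Y has_vector_derivative k * (W x / (f x)\<^sup>2)) (at x within {0..b})"
  shows "((\<lambda>x. f x * Y x) has_vector_derivative f' x * Y x + k * W x / f x) (at x within {0..b})"
    and "(W has_vector_derivative c * Z * (f x)\<^sup>2) (at x within {0..b}) \<Longrightarrow>
      ((\<lambda>x. f' x * Y x + k * W x / f x) has_vector_derivative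
        q x * (f x * Y x) + k * c * (f x * Z)) (at x within {0..b})"
proof -
  show "((\<lambda>x. f x * Y x) has_vector_derivative f' x * Y x + k * W x / f x) (at x within {0..b})"
    using has_vector_derivative_mult[OF f_deriv[OF x] Y]
    by (rule back_subst[where P = "\<lambda>d. (_ has_vector_derivative d) _"])
      (use f_nz[OF x] in \<open>simp add: divide_simps power2_eq_square\<close>)
  assume W: "(W has_vector_derivative c * Z * (f x)\<^sup>2) (at x within {0..b})"
  have "(inverse has_field_derivative - inverse ((f x)\<^sup>2)) (at (f x) within f ` {0..b})"
    using DERIV_inverse[OF f_nz[OF x]] by (auto intro: DERIV_subset simp: power2_eq_square)
  note inv = field_vector_diff_chain_within[OF f_deriv[OF x] this, unfolded o_def]
  show "((\<lambda>x. f' x * Y x + k * W x / f x) has_vector_derivative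
      q x * (f x * Y x) + k * c * (f x * Z)) (at x within {0..b})"
    unfolding divide_inverse
    using has_vector_derivative_add[OF has_vector_derivative_mult[OF f'_deriv[OF x] Y]
        has_vector_derivative_mult[OF has_vector_derivative_mult_right[OF W, of k] inv]]
    by (rule back_subst[where P = "\<lambda>d. (_ has_vector_derivative d) _"])
      (use f_nz[OF x] in \<open>simp add: field_simps power2_eq_square\<close>)
qed

text \<open>Two integrations in the same family change the index by 2 and use the weights 1/f^2 and
  f^2 once each, which is one Darboux step. For k < 2 the factor k (k - 1) vanishes, so the
  truncated index k - 2 does no harm.\<close>

lemma
  assumes x: "x \<in> {0..b}"
  shows phi_deriv: "(phi f k has_vector_derivative phi' k x) (at x within {0..b})"
    and phi'_deriv: "(phi' k has_vector_derivative
      q x * phi f k x + of_nat k * of_nat (k - 1) * phi f (k - 2) x) (at x within {0..b})"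
proof -
  have "(phi f k has_vector_derivative phi' k x) (at x within {0..b}) \<and>
    (phi' k has_vector_derivative
      q x * phi f k x + of_nat k * of_nat (k - 1) * phi f (k - 2) x) (at x within {0..b})"
  proof -
    consider "k = 0" | "k = 1" | m where "k = Suc (Suc m)" "even m" | m where "k = Suc (Suc m)" "odd m"
      by (metis One_nat_def not0_implies_Suc)
    then show ?thesis
    proof cases
      case 1
      then have "phi f k = f" "phi' k = f'"
        by (auto simp: phi_def phi'_def)
      then show ?thesis using f_deriv[OF x] f'_deriv[OF x] 1 by simp
    next
      case 2
      then have "phi f k = (\<lambda>x. f x * rec_X f (Suc 0) x)"
        "phi' k = (\<lambda>x. f' x * rec_X f (Suc 0) x + of_nat (Suc 0) * rec_X f 0 x / f x)"
        by (auto simp: phi_def phi'_def simp del: rec_X.simps(2))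
      then show ?thesis
        using darboux_step(1)[OF x, where Y = "rec_X f (Suc 0)" and W = "rec_X f 0" and k = "of_nat (Suc 0)"]
          darboux_step(2)[OF x, where Y = "rec_X f (Suc 0)" and W = "rec_X f 0" and k = "of_nat (Suc 0)"
            and c = 0 and Z = 0] rec_X_deriv(1)[OF x, of 0] 2
        by (simp add: phi_def del: rec_X.simps(2))
    next
      case 3
      then have "phi f k = (\<lambda>x. f x * rec_Xt f (Suc (Suc m)) x)" "phi f (k - 2) = (\<lambda>x. f x * rec_Xt f m x)"
        "phi' k = (\<lambda>x. f' x * rec_Xt f (Suc (Suc m)) x + of_nat (Suc (Suc m)) * rec_Xt f (Suc m) x / f x)"
        by (auto simp: phi_def phi'_def simp del: rec_Xt.simps(2) of_nat_Suc)
      then show ?thesis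
        using darboux_step(1)[OF x, where Y = "rec_Xt f (Suc (Suc m))" and W = "rec_Xt f (Suc m)" and k = "of_nat (Suc (Suc m))"]
          darboux_step(2)[OF x, where Y = "rec_Xt f (Suc (Suc m))" and W = "rec_Xt f (Suc m)" and k = "of_nat (Suc (Suc m))"
            and c = "of_nat (Suc m)" and Z = "rec_Xt f m x"]
          rec_Xt_deriv(1)[OF x, of "Suc m"] rec_Xt_deriv(2)[OF x, of m] 3
        by (simp del: rec_Xt.simps(2) of_nat_Suc)
    next
      case 4
      then have "phi f k = (\<lambda>x. f x * rec_X f (Suc (Suc m)) x)" "phi f (k - 2) = (\<lambda>x. f x * rec_X f m x)"
        "phi' k = (\<lambda>x. f' x * rec_X f (Suc (Suc m)) x + of_nat (Suc (Suc m)) * rec_X f (Suc m) x / f x)"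
        by (auto simp: phi_def phi'_def simp del: rec_X.simps(2) of_nat_Suc)
      then show ?thesis
        using darboux_step(1)[OF x, where Y = "rec_X f (Suc (Suc m))" and W = "rec_X f (Suc m)" and k = "of_nat (Suc (Suc m))"]
          darboux_step(2)[OF x, where Y = "rec_X f (Suc (Suc m))" and W = "rec_X f (Suc m)" and k = "of_nat (Suc (Suc m))"
            and c = "of_nat (Suc m)" and Z = "rec_X f m x"]
          rec_X_deriv(1)[OF x, of "Suc m"] rec_X_deriv(2)[OF x, of m] 4
        by (simp del: rec_X.simps(2) of_nat_Suc)
    qed
  qed
  then show "(phi f k has_vector_derivative phi' k x) (at x within {0..b})"
    and "(phi' k has_vector_derivative
      q x * phi f k x + of_nat k * of_nat (k - 1) * phi f (k - 2) x) (at x within {0..b})"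
    by auto
qed

lemma phi_0: "phi f k 0 = (if k = 0 then 1 else 0)"
  by (cases k) (auto simp: phi_def f_0)

lemma phi'_0: "phi' k 0 = (if k = 0 then f' 0 else if k = 1 then 1 else 0)"
proof -
  consider "k = 0" | "k = 1" | m where "k = Suc (Suc m)"
    by (metis One_nat_def not0_implies_Suc)
  then show ?thesis
    by cases (auto simp: phi'_def f_0)
qed

lemma phi_odd_bound:
  assumes "x \<in> {0..b}" "odd k"
  shows "norm (phi f k x) \<le> norm (f x) * (weight_bound * x) ^ k"
  using assms by (auto simp: phi_def norm_mult intro!: mult_left_mono rec_X_bound)

text \<open>Because phi_k'' = q phi_k + k (k - 1) phi_{k-2}, the coefficients make the partial sums
  telescope: they have the right initial values and satisfy the equation up to the single residual
  lam * c_m * phi_{2m+1}. This residual tends to 0 uniformly, and stability of the equation carries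
  the convergence over to the solution.\<close>

lemma phi_series_sums:
  assumes u: "ivp_solution b q lam 0 1 u"
  shows "(\<lambda>k. (- lam) ^ k / fact (2 * k + 1) * phi f (2 * k + 1) b) sums u b"
proof -
  obtain u' where u: "\<And>x. x \<in> {0..b} \<Longrightarrow> (u has_vector_derivative u' x) (at x within {0..b})"
      "\<And>x. x \<in> {0..b} \<Longrightarrow> (u' has_vector_derivative q x * u x - lam * u x) (at x within {0..b})"
      "u 0 = 0" "u' 0 = 1"
    using ivp_solutionE[OF u] by metis
  define c :: "nat \<Rightarrow> complex" where "c = (\<lambda>k. (- lam) ^ k / fact (2 * k + 1))"
  define S where "S = (\<lambda>m x. \<Sum>k<m. c k * phi f (2 * k + 1) x)"
  define S' where "S' = (\<lambda>m x. \<Sum>k<m. c k * phi' (2 * k + 1) x)"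
  have c_Suc: "c (Suc m) * (of_nat (2 * m + 3) * of_nat (2 * m + 2)) = - lam * c m" for m
  proof -
    have "(fact (2 * Suc m + 1) :: complex) = of_nat (2 * m + 3) * of_nat (2 * m + 2) * fact (2 * m + 1)"
      by (simp add: algebra_simps)
    moreover have "(of_nat (2 * m + 3) * of_nat (2 * m + 2) :: complex) \<noteq> 0"
      by (simp only: of_nat_mult[symmetric] of_nat_eq_0_iff) simp
    moreover have "A / (X * F) * X = A / F" if "X \<noteq> 0" for A X F :: complex
      using that by simp
    ultimately show ?thesis
      unfolding c_def by (simp only: power_Suc times_divide_eq_right)
  qed
  have S_deriv: "(S m has_vector_derivative S' m x) (at x within {0..b})" if "x \<in> {0..b}" for m x
    unfolding S_def S'_def
    by (intro has_vector_derivative_sum has_vector_derivative_mult_right phi_deriv that)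
  have S'_deriv: "(S' (Suc m) has_vector_derivative
      (q x - lam) * S (Suc m) x + lam * (c m * phi f (2 * m + 1) x)) (at x within {0..b})"
    if x: "x \<in> {0..b}" for m x
  proof (induction m)
    case 0
    have "S' (Suc 0) = phi' 1" "S (Suc 0) = phi f 1" by (auto simp: S_def S'_def c_def)
    then show ?case
      using phi'_deriv[OF x, of 1] by (simp add: c_def algebra_simps)
  next
    case (Suc m)
    let ?k = "2 * Suc m + 1"
    have k: "?k = 2 * m + 3" "?k - 1 = 2 * m + 2" "?k - 2 = 2 * m + 1"
      "2 * m + 3 - 1 = 2 * m + 2" "2 * m + 3 - 2 = 2 * m + 1" by auto
    have "S' (Suc (Suc m)) = (\<lambda>x. S' (Suc m) x + c (Suc m) * phi' ?k x)"
      by (auto simp: S'_def)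
    then have "(S' (Suc (Suc m)) has_vector_derivative
        ((q x - lam) * S (Suc m) x + lam * (c m * phi f (2 * m + 1) x)) + c (Suc m) * (q x * phi f ?k x
        + of_nat (2 * m + 3) * of_nat (2 * m + 2) * phi f (2 * m + 1) x)) (at x within {0..b})"
      using has_vector_derivative_add[OF Suc has_vector_derivative_mult_right[OF phi'_deriv[OF x, of ?k], of "c (Suc m)"]]
      by (simp only: k)
    moreover have "((q x - lam) * S (Suc m) x + lam * (c m * phi f (2 * m + 1) x)) + c (Suc m) * (q x * phi f ?k x
        + of_nat (2 * m + 3) * of_nat (2 * m + 2) * phi f (2 * m + 1) x)
      = (q x - lam) * S (Suc m) x + lam * (c m * phi f (2 * m + 1) x) + c (Suc m) * q x * phi f ?k x
        + (c (Suc m) * (of_nat (2 * m + 3) * of_nat (2 * m + 2))) * phi f (2 * m + 1) x"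
      by (simp only: algebra_simps)
    moreover have "\<dots> = (q x - lam) * S (Suc (Suc m)) x + lam * (c (Suc m) * phi f ?k x)"
      unfolding c_Suc by (simp add: S_def algebra_simps)
    ultimately show ?case by (simp only:)
  qed
  have "continuous_on {0..b} (\<lambda>x. q x - lam + 1)"
    by (intro continuous_intros q_cont)
  then obtain Q where Q: "\<And>x. x \<in> {0..b} \<Longrightarrow> norm (q x - lam + 1) \<le> Q"
    using compact_imp_bounded[OF compact_continuous_image[OF _ compact_Icc]] by (fastforce simp: bounded_iff)
  obtain F where F: "\<And>x. x \<in> {0..b} \<Longrightarrow> norm (f x) \<le> F"
    using compact_imp_bounded[OF compact_continuous_image[OF f_cont compact_Icc]] by (fastforce simp: bounded_iff)
  define M where "M = weight_bound"
  have M: "0 \<le> M"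
    using weight_bound[of 0 0] b_pos unfolding M_def by (auto intro: order_trans[OF norm_ge_zero])
  have F0: "0 \<le> F"
    using F[of 0] b_pos by (auto intro: order_trans[OF norm_ge_zero])
  \<comment> \<open>Bounds the residual via \<open>phi_odd_bound\<close> and (2m + 1)! >= m!. Up to
    a constant factor it is the general term of the exponential series at |lam| (M b)^2, hence a
    null sequence.\<close>
  define K where "K = (\<lambda>m. norm lam * (norm lam ^ m / fact m * (F * (M * b) ^ (2 * m + 1))))"
  have K: "norm (lam * (c m * phi f (2 * m + 1) x)) \<le> K m" if x: "x \<in> {0..b}" for m x
    unfolding norm_mult K_def
  proof (intro mult_left_mono mult_mono)
    have "fact m \<le> (fact (2 * m + 1) :: real)"
      by (intro fact_mono) auto
    then show "norm (c m) \<le> norm lam ^ m / fact m"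
      by (simp add: c_def norm_divide norm_power frac_le del: fact_Suc)
    have "norm (phi f (2 * m + 1) x) \<le> norm (f x) * (M * x) ^ (2 * m + 1)"
      unfolding M_def by (rule phi_odd_bound[OF x]) auto
    also have "\<dots> \<le> F * (M * b) ^ (2 * m + 1)"
      using x M F0 by (intro mult_mono F power_mono) auto
    finally show "norm (phi f (2 * m + 1) x) \<le> F * (M * b) ^ (2 * m + 1)" .
  qed auto
  have bound: "norm (u b - S (Suc m) b) \<le> K m * (b * exp (Q * b))" for m
  proof -
    \<comment> \<open>The perturbation bound is used at the fixed frequency 1, with the coefficient
      q - lam replaced by (q - lam + 1) - 1^2; this covers every lam, including 0.\<close>
    have "norm (u b - S (Suc m) b) \<le> (K m / norm (1::complex) + 0) * b * exp (Q * b) * exp (\<bar>Im 1\<bar> * b)"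
    proof (rule perturbation_bound[where e' = "\<lambda>x. u' x - S' (Suc m) x" and q = "\<lambda>x. q x - lam + 1"
          and g = "\<lambda>x. - (lam * (c m * phi f (2 * m + 1) x))" and p = "\<lambda>_. 0" and p' = "\<lambda>_. 0"])
      fix x assume x: "x \<in> {0..b}"
      show "((\<lambda>x. u x - S (Suc m) x) has_vector_derivative u' x - S' (Suc m) x) (at x within {0..b})"
        by (intro has_vector_derivative_diff u S_deriv x)
      show "((\<lambda>x. u' x - S' (Suc m) x) has_vector_derivative
        (q x - lam + 1) * (u x - S (Suc m) x) - 1\<^sup>2 * (u x - S (Suc m) x) +
          - (lam * (c m * phi f (2 * m + 1) x)) + 0 * sin (1 * of_real x)) (at x within {0..b})"
        using has_vector_derivative_diff[OF u(2)[OF x] S'_deriv[OF x, of m]]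
        by (rule back_subst[where P = "\<lambda>d. (_ has_vector_derivative d) _"])
          (simp add: algebra_simps)
      show "norm (- (lam * (c m * phi f (2 * m + 1) x))) \<le> K m * exp (\<bar>Im 1\<bar> * x)"
        using K[OF x, of m] by simp
    next
      show "u' 0 - S' (Suc m) 0 = 0"
        unfolding S'_def by (subst sum.lessThan_Suc_shift) (simp add: u(4) phi'_0 c_def)
      show "u 0 - S (Suc m) 0 = 0"
        by (simp add: S_def u(3) phi_0)
    qed (use Q b_pos in auto)
    then show ?thesis by (simp add: mult.assoc)
  qed
  have "(\<lambda>m. norm lam * F * (M * b) * ((norm lam * (M * b)\<^sup>2) ^ m / fact m)) \<longlonglongrightarrow> norm lam * F * (M * b) * 0"
    using summable_LIMSEQ_zero[OF summable_exp[of "norm lam * (M * b)\<^sup>2"]]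
    by (intro tendsto_mult tendsto_const) (simp add: divide_inverse mult.commute)
  also have "(\<lambda>m. norm lam * F * (M * b) * ((norm lam * (M * b)\<^sup>2) ^ m / fact m)) = K"
    by (auto simp: K_def power_mult_distrib power_mult[symmetric] power_add mult_ac)
  finally have "(\<lambda>m. K m * (b * exp (Q * b))) \<longlonglongrightarrow> 0 * (b * exp (Q * b))"
    by (intro tendsto_mult tendsto_const) simp
  then have "(\<lambda>m. u b - S (Suc m) b) \<longlonglongrightarrow> 0"
    by (intro Lim_null_comparison[OF always_eventually[OF allI[OF bound]]]) simp
  then have "(\<lambda>m. u b - (u b - S (Suc m) b)) \<longlonglongrightarrow> u b - 0"
    by (intro tendsto_diff tendsto_const)
  then have "(\<lambda>m. S (Suc m) b) \<longlonglongrightarrow> u b"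
    by simp
  then show ?thesis
    unfolding sums_def S_def c_def by (subst (asm) filterlim_sequentially_Suc)
qed

text \<open>The family \<open>s\<close> is given pointwise in w, so holomorphy must come from the
  series in lam = w^2. That series converges for every lam, hence defines an entire function
  \<open>P\<close>. The square root only names some solution for the parameter z; uniqueness of sums
  identifies P(w^2) with s(w, b).\<close>

lemma ivp_solution_holomorphic:
  assumes s: "\<And>w. ivp_solution b q (w\<^sup>2) 0 1 (s w)"
  shows "(\<lambda>w. s w b) holomorphic_on UNIV"
proof -
  define P where "P = (\<lambda>z. s (csqrt z) b)"
  have sums: "(\<lambda>k. ((- 1) ^ k / fact (2 * k + 1) * phi f (2 * k + 1) b) * z ^ k) sums P z" for z
    using phi_series_sums[of z "s (csqrt z)"] s[of "csqrt z"]
    by (simp add: P_def power_minus[of z] mult_ac del: fact_Suc)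
  have "P holomorphic_on UNIV"
  proof -
    have "P holomorphic_on ball 0 (norm z + 1)" for z
      by (rule power_series_holomorphic[of _ _ "\<lambda>k. (- 1) ^ k / fact (2 * k + 1) * phi f (2 * k + 1) b"])
        (use sums in simp)
    then have "P field_differentiable at z" for z
      using holomorphic_on_imp_differentiable_at[of P "ball 0 (norm z + 1)" z] by auto
    then show ?thesis
      by (simp add: holomorphic_on_def)
  qed
  then have "(\<lambda>w. P (w\<^sup>2)) holomorphic_on UNIV"
    by (intro holomorphic_on_compose_gen[of "\<lambda>w. w\<^sup>2" UNIV P UNIV, unfolded o_def] holomorphic_intros) auto
  moreover have "P (w\<^sup>2) = s w b" for w
    using sums_unique2[OF phi_series_sums[OF s[of w]] phi_series_sums[of "w\<^sup>2" "s (csqrt (w\<^sup>2))"]]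
      s[of "csqrt (w\<^sup>2)"] by (simp add: P_def)
  ultimately show ?thesis by simp
qed

end

section \<open>Sine moments, the equation satisfied by w s_N, and the error estimates at x =
  b\<close>

subsection \<open>The approximate solution\<close>

definition sin_moment :: "nat \<Rightarrow> complex \<Rightarrow> real \<Rightarrow> complex" where
  "sin_moment k w x = integral {0..x} (\<lambda>t. of_real t ^ k * sin (w * of_real t))"

lemma sin_moment_0: "sin_moment k w 0 = 0"
  by (simp add: sin_moment_def)

lemma sin_moment_zero: "sin_moment k 0 x = 0"
  by (simp add: sin_moment_def)

lemma sin_moment_deriv:
  assumes "x \<in> {0..b}"
  shows "(sin_moment k w has_vector_derivative of_real x ^ k * sin (w * of_real x)) (at x within {0..b})"
  unfolding sin_moment_def[abs_def]
  by (rule integral_has_vector_derivative[OF _ assms]) (intro continuous_intros)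

lemma sin_moment_holomorphic: "(\<lambda>w. sin_moment k w x) holomorphic_on UNIV"
  unfolding sin_moment_def cbox_interval[symmetric]
proof (rule leibniz_rule_holomorphic)
  show "((\<lambda>w. of_real t ^ k * sin (w * of_real t)) has_field_derivative
      of_real t ^ k * (cos (w * of_real t) * of_real t)) (at w within UNIV)" for w :: complex and t
    by (auto intro!: derivative_eq_intros)
  show "(\<lambda>t. of_real t ^ k * sin (w * of_real t)) integrable_on cbox 0 x" for w :: complex
    by (intro integrable_continuous continuous_intros)
  show "continuous_on (UNIV \<times> cbox 0 x)
      (\<lambda>(w :: complex, t). of_real t ^ k * (cos (w * of_real t) * of_real t))"
    unfolding split_beta by (intro continuous_intros)
qed auto

lemma has_vector_derivative_power_of_real:
  "((\<lambda>t. of_real t ^ k :: complex) has_vector_derivative of_nat k * of_real x ^ (k - 1)) (at x within S)"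
proof -
  have "((\<lambda>z. z ^ k) has_field_derivative (of_nat k * of_real x ^ (k - 1) :: complex)) (at (of_real x))"
    by (auto intro!: derivative_eq_intros)
  from has_vector_derivative_real_field[OF this] show ?thesis .
qed

lemma has_vector_derivative_sin_of_real:
  fixes w :: complex
  shows "((\<lambda>t. sin (w * of_real t)) has_vector_derivative w * cos (w * of_real x)) (at x within S)"
proof -
  have "((\<lambda>z. sin (w * z)) has_field_derivative w * cos (w * of_real x)) (at (of_real x))"
    by (auto intro!: derivative_eq_intros)
  from has_vector_derivative_real_field[OF this] show ?thesis .
qed

lemma has_vector_derivative_cos_of_real:
  fixes w :: complex
  shows "((\<lambda>t. cos (w * of_real t)) has_vector_derivative - w * sin (w * of_real x)) (at x within S)"
proof -
  have "((\<lambda>z. cos (w * z)) has_field_derivative - w * sin (w * of_real x)) (at (of_real x))"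
    by (auto intro!: derivative_eq_intros)
  from has_vector_derivative_real_field[OF this] show ?thesis .
qed

lemma sin_moment_recurrence:
  assumes k: "1 \<le> k" and x: "0 \<le> x"
  shows "of_nat k * of_nat (k - 1) * sin_moment (k - 2) w x =
    of_nat k * of_real x ^ (k - 1) * sin (w * of_real x) - w * of_real x ^ k * cos (w * of_real x)
    - w\<^sup>2 * sin_moment k w x"
proof -
  \<comment> \<open>The boundary expression of two integrations by parts, with \<open>D\<close> its
    derivative. The condition k >= 1 makes it vanish at 0; for k = 1 the truncated exponent k - 2
    has coefficient 0.\<close>
  define A where "A = (\<lambda>t. of_nat k * of_real t ^ (k - 1) * sin (w * of_real t)
    - w * of_real t ^ k * cos (w * of_real t))"
  define D where "D = (\<lambda>t. of_nat k * of_nat (k - 1) * (of_real t ^ (k - 2) * sin (w * of_real t))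
    + w\<^sup>2 * (of_real t ^ k * sin (w * of_real t)))"
  have "(A has_vector_derivative D t) (at t within {0..x})" for t
  proof -
    have "k - 1 - 1 = k - 2" by simp
    then show ?thesis
      unfolding A_def
      using has_vector_derivative_diff[OF
          has_vector_derivative_mult[OF has_vector_derivative_mult_right[OF has_vector_derivative_power_of_real[of "k - 1"], of "of_nat k"]
            has_vector_derivative_sin_of_real[of w]]
          has_vector_derivative_mult[OF has_vector_derivative_mult_right[OF has_vector_derivative_power_of_real[of k], of w]
            has_vector_derivative_cos_of_real[of w]], of t "{0..x}"]
      by (rule_tac back_subst[where P = "\<lambda>d. (_ has_vector_derivative d) _"])
        (simp_all add: D_def algebra_simps power2_eq_square)
  qed
  then have "(D has_integral A x - A 0) {0..x}"
    by (intro fundamental_theorem_of_calculus x)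
  moreover have "A 0 = 0"
    using k by (simp add: A_def)
  moreover have "integral {0..x} D = of_nat k * of_nat (k - 1) * sin_moment (k - 2) w x + w\<^sup>2 * sin_moment k w x"
    unfolding D_def sin_moment_def
    by (subst integral_add) (auto intro!: integrable_continuous_interval continuous_intros)
  ultimately have "of_nat k * of_nat (k - 1) * sin_moment (k - 2) w x + w\<^sup>2 * sin_moment k w x = A x"
    by (simp add: has_integral_iff)
  then show ?thesis
    by (simp only: A_def eq_diff_eq)
qed

text \<open>Both sides are n! / (k! (n - k - 2)!).\<close>

lemma choose_shift_two:
  assumes "k + 2 \<le> n"
  shows "(n choose k) * ((n - k) * (n - k - 1)) = (n choose (k + 2)) * ((k + 2) * (k + 1))"
proof -
  have 1: "(n choose Suc j) * Suc j = (n choose j) * (n - j)" if "j < n" for j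
    using binomial_absorb_comp[of n j] binomial_absorption[of j n] that
    by (simp add: mult.commute)
  have "(n choose k) * ((n - k) * (n - k - 1)) = ((n choose k) * (n - k)) * (n - Suc k)"
    by (simp add: mult.assoc)
  also have "\<dots> = ((n choose Suc k) * (n - Suc k)) * Suc k"
  proof -
    have *: "(n choose k) * (n - k) = (n choose Suc k) * Suc k"
      using 1[of k] assms by simp
    show ?thesis unfolding * by (simp only: mult_ac)
  qed
  also have "\<dots> = (n choose Suc (Suc k)) * Suc (Suc k) * Suc k"
    using 1[of "Suc k"] assms by simp
  finally show ?thesis by (simp add: algebra_simps)
qed

context nonvanishing_solution
begin

abbreviation odd_upto :: "nat \<Rightarrow> nat set" where
  "odd_upto n \<equiv> {k. 1 \<le> k \<and> k \<le> n \<and> odd k}"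

text \<open>The factor multiplying 2 b_n in w s_N(w, x). The primed functions below are derivatives
  in x.\<close>

definition wave_term :: "nat \<Rightarrow> complex \<Rightarrow> real \<Rightarrow> complex" where
  "wave_term n w x = (\<Sum>k\<in>odd_upto n. of_nat (n choose k) * (phi f (n - k) x * sin_moment k w x))"

definition wave_term' :: "nat \<Rightarrow> complex \<Rightarrow> real \<Rightarrow> complex" where
  "wave_term' n w x = (\<Sum>k\<in>odd_upto n. of_nat (n choose k) *
    (phi f (n - k) x * (of_real x ^ k * sin (w * of_real x)) + phi' (n - k) x * sin_moment k w x))"

definition s_fun' :: "nat \<Rightarrow> real \<Rightarrow> complex" where
  "s_fun' n x = (\<Sum>k\<in>odd_upto n. of_nat (n choose k) *
    (of_real x ^ k * phi' (n - k) x + of_nat k * of_real x ^ (k - 1) * phi f (n - k) x))"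

lemma s_fun_deriv:
  assumes x: "x \<in> {0..b}"
  shows "(s_fun f n has_vector_derivative s_fun' n x) (at x within {0..b})"
  unfolding s_fun_def[abs_def] mult.assoc unfolding s_fun'_def
  by (intro has_vector_derivative_sum has_vector_derivative_mult_right has_vector_derivative_mult
      has_vector_derivative_power_of_real phi_deriv x)

lemma wave_term_deriv:
  assumes x: "x \<in> {0..b}"
  shows "(wave_term n w has_vector_derivative wave_term' n w x) (at x within {0..b})"
  unfolding wave_term_def[abs_def] wave_term'_def
  by (intro has_vector_derivative_sum has_vector_derivative_mult_right has_vector_derivative_mult
      sin_moment_deriv phi_deriv x)

text \<open>Moves the index shift from the formal powers to the factors \<open>c\<close>. With c_k
  the sine moments, the terms phi_{n-k-2} J_k produced by phi_{n-k}'' become phi_{n-k} J_{k-2}, to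
  which the moment recurrence applies.\<close>

lemma sum_odd_shift:
  fixes c :: "nat \<Rightarrow> complex"
  shows "(\<Sum>k\<in>odd_upto n. of_nat (n choose k) * (of_nat (n - k) * of_nat (n - k - 1) * phi f (n - k - 2) x * c k))
    = (\<Sum>k\<in>odd_upto n. of_nat (n choose k) * (phi f (n - k) x * (of_nat k * of_nat (k - 1) * c (k - 2))))"
\<comment> \<open>The shift k to k + 2 misses only zero terms: on the left those with k > n - 2,
  where (n - k)(n - k - 1) = 0, and on the right k = 1, where k - 1 = 0.\<close>
proof (rule sum.reindex_bij_witness_not_neutral[where i = "\<lambda>k. k - 2" and j = "\<lambda>k. k + 2"
    and S' = "{k \<in> odd_upto n. n < k + 2}" and T' = "{1} \<inter> odd_upto n"])
  fix k assume "k \<in> odd_upto n"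
  show "of_nat (n choose (k + 2)) * (phi f (n - (k + 2)) x * (of_nat (k + 2) * of_nat (k + 2 - 1) * c (k + 2 - 2)))
    = of_nat (n choose k) * (of_nat (n - k) * of_nat (n - k - 1) * phi f (n - k - 2) x * c k)"
  proof (cases "k + 2 \<le> n")
    case True
    then have "of_nat (n choose (k + 2)) * (of_nat (k + 2) * of_nat (k + 2 - 1)) =
      (of_nat (n choose k) * (of_nat (n - k) * of_nat (n - k - 1)) :: complex)"
      unfolding of_nat_mult[symmetric] of_nat_eq_iff using choose_shift_two[OF True] by simp
    then show ?thesis
      by (simp del: of_nat_add of_nat_mult binomial_Suc_Suc add: mult_ac)
  next
    case False
    then have "(n choose (k + 2)) = 0" "n - k = 0 \<or> n - k - 1 = 0"
      by auto
    then show ?thesis by auto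
  qed
next
  fix k assume "k \<in> odd_upto n - {1} \<inter> odd_upto n"
  then have "odd k" "3 \<le> k" "k \<le> n"
    by (auto simp: numeral_3_eq_3 Suc_le_eq) (metis One_nat_def even_Suc even_zero less_antisym less_one nat_neq_iff not_less_eq numeral_2_eq_2)
  then show "k - 2 + 2 = k" "k - 2 \<in> odd_upto n - {k \<in> odd_upto n. n < k + 2}"
    by auto
next
  fix k assume "k \<in> {k \<in> odd_upto n. n < k + 2}"
  then have "n - k = 0 \<or> n - k - 1 = 0"
    by auto
  then show "of_nat (n choose k) * (of_nat (n - k) * of_nat (n - k - 1) * phi f (n - k - 2) x * c k) = 0"
    by auto
qed auto

text \<open>After the shift and the moment recurrence, the cosine terms w x^k cos(w x) cancel and
  the terms k x^(k-1) sin(w x) double. Together with the doubled phi_{n-k}' terms they assemble into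
  twice the derivative of s_n, times sin(w x).\<close>

lemma wave_term'_deriv:
  assumes x: "x \<in> {0..b}"
  shows "(wave_term' n w has_vector_derivative
    q x * wave_term n w x - w\<^sup>2 * wave_term n w x + 2 * s_fun' n x * sin (w * of_real x)) (at x within {0..b})"
proof -
  have dmon: "((\<lambda>x. of_real x ^ k * sin (w * of_real x)) has_vector_derivative
      (of_real x ^ k * (w * cos (w * of_real x)) + of_nat k * of_real x ^ (k - 1) * sin (w * of_real x))) (at x within {0..b})" for k
    by (intro has_vector_derivative_mult has_vector_derivative_power_of_real has_vector_derivative_sin_of_real)
  let ?S = "sin (w * of_real x)" and ?C = "cos (w * of_real x)"
  let ?b = "\<lambda>k. of_nat (n choose k) :: complex" and ?p = "\<lambda>k. phi f (n - k) x" and ?J = "\<lambda>k. sin_moment k w x"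
  have "(wave_term' n w has_vector_derivative (\<Sum>k\<in>odd_upto n. ?b k *
      ((?p k * (of_real x ^ k * (w * ?C) + of_nat k * of_real x ^ (k - 1) * ?S) + phi' (n - k) x * (of_real x ^ k * ?S))
      + (phi' (n - k) x * (of_real x ^ k * ?S)
        + (q x * ?p k + of_nat (n - k) * of_nat (n - k - 1) * phi f (n - k - 2) x) * ?J k)))) (at x within {0..b})"
    unfolding wave_term'_def[abs_def]
    by (intro has_vector_derivative_sum has_vector_derivative_mult_right has_vector_derivative_add
      has_vector_derivative_mult sin_moment_deriv dmon phi_deriv phi'_deriv x)
  also have "(\<Sum>k\<in>odd_upto n. ?b k *
      ((?p k * (of_real x ^ k * (w * ?C) + of_nat k * of_real x ^ (k - 1) * ?S) + phi' (n - k) x * (of_real x ^ k * ?S))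
      + (phi' (n - k) x * (of_real x ^ k * ?S)
        + (q x * ?p k + of_nat (n - k) * of_nat (n - k - 1) * phi f (n - k - 2) x) * ?J k)))
    = (\<Sum>k\<in>odd_upto n. ?b k * (?p k * (of_real x ^ k * (w * ?C) + of_nat k * of_real x ^ (k - 1) * ?S)
        + 2 * phi' (n - k) x * of_real x ^ k * ?S + q x * ?p k * ?J k))
      + (\<Sum>k\<in>odd_upto n. ?b k * (of_nat (n - k) * of_nat (n - k - 1) * phi f (n - k - 2) x * ?J k))"
    unfolding sum.distrib[symmetric] by (intro sum.cong refl) (simp only: algebra_simps mult_2)
  also have "\<dots> = (\<Sum>k\<in>odd_upto n. ?b k * (?p k * (of_real x ^ k * (w * ?C) + of_nat k * of_real x ^ (k - 1) * ?S)
        + 2 * phi' (n - k) x * of_real x ^ k * ?S + q x * ?p k * ?J k))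
      + (\<Sum>k\<in>odd_upto n. ?b k * (?p k *
        (of_nat k * of_real x ^ (k - 1) * ?S - w * of_real x ^ k * ?C - w\<^sup>2 * ?J k)))"
    unfolding sum_odd_shift using x
    by (intro arg_cong2[where f = "(+)"] refl sum.cong arg_cong2[where f = "(*)"] sin_moment_recurrence) auto
  also have "\<dots> = q x * wave_term n w x - w\<^sup>2 * wave_term n w x + 2 * s_fun' n x * sin (w * of_real x)"
    unfolding wave_term_def s_fun'_def sum_distrib_left sum_distrib_right
      sum.distrib[symmetric] sum_subtractf[symmetric]
    by (intro sum.cong refl) (simp only: algebra_simps mult_2)
  finally show ?thesis .
qed

definition s_numerator :: "nat \<Rightarrow> (nat \<Rightarrow> complex) \<Rightarrow> complex \<Rightarrow> real \<Rightarrow> complex" where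
  "s_numerator N \<beta> w x = sin (w * of_real x) + 2 * (\<Sum>n = 1..N. \<beta> n * wave_term n w x)"

lemma s_numerator_holomorphic: "(\<lambda>w. s_numerator N \<beta> w x) holomorphic_on UNIV"
  unfolding s_numerator_def wave_term_def
  by (intro holomorphic_intros sin_moment_holomorphic)

text \<open>The numerator is entire in w and vanishes at 0, so its quotient by w, completed by the
  derivative at 0, is an entire function \<open>G\<close>. As \<open>G\<close> is continuous and
  agrees with the defining formula off 0, its value is the limit picked by
  \<open>remove_sings\<close> at every point.\<close>

lemma s_approx_entire:
  shows s_approx_holomorphic: "(\<lambda>w. s_approx f N \<beta> w x) holomorphic_on UNIV"
    and s_approx_eq: "w \<noteq> 0 \<Longrightarrow> w * s_approx f N \<beta> w x = s_numerator N \<beta> w x"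
proof -
  let ?H = "\<lambda>w. s_numerator N \<beta> w x"
  define G where "G = (\<lambda>w. if w = 0 then deriv ?H 0 else (?H w - ?H 0) / (w - 0))"
  have H0: "?H 0 = 0"
    by (simp add: s_numerator_def wave_term_def sin_moment_zero)
  have G: "G holomorphic_on UNIV"
    unfolding G_def by (rule pole_lemma_open[OF s_numerator_holomorphic]) auto
  have eq: "s_approx f N \<beta> w x = G w" for w
    unfolding s_approx_def
  proof (rule remove_sings_eqI)
    have "G \<midarrow>w\<rightarrow> G w"
      using holomorphic_on_imp_continuous_on[OF G] by (simp add: continuous_on_eq_continuous_at isCont_def)
    moreover have "eventually (\<lambda>\<omega>. \<omega> \<noteq> 0) (at w)"
      by (rule eventually_neq_at_within)
    then have "eventually (\<lambda>\<omega>. G \<omega> = 1 / \<omega> * (sin (\<omega> * of_real x) + 2 * (\<Sum>n = 1..N. \<beta> n *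
        (\<Sum>k | 1 \<le> k \<and> k \<le> n \<and> odd k. of_nat (n choose k) * phi f (n - k) x *
           integral {0..x} (\<lambda>t. of_real t ^ k * sin (\<omega> * of_real t)))))) (at w)"
    proof (rule eventually_mono)
      fix \<omega> :: complex assume "\<omega> \<noteq> 0"
      then have "G \<omega> = 1 / \<omega> * s_numerator N \<beta> \<omega> x"
        by (simp add: G_def H0)
      then show "G \<omega> = 1 / \<omega> * (sin (\<omega> * of_real x) + 2 * (\<Sum>n = 1..N. \<beta> n *
        (\<Sum>k | 1 \<le> k \<and> k \<le> n \<and> odd k. of_nat (n choose k) * phi f (n - k) x *
           integral {0..x} (\<lambda>t. of_real t ^ k * sin (\<omega> * of_real t)))))"
        by (simp only: s_numerator_def wave_term_def sin_moment_def mult.assoc)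
    qed
    ultimately show "(\<lambda>\<omega>. 1 / \<omega> * (sin (\<omega> * of_real x) + 2 * (\<Sum>n = 1..N. \<beta> n *
        (\<Sum>k | 1 \<le> k \<and> k \<le> n \<and> odd k. of_nat (n choose k) * phi f (n - k) x *
           integral {0..x} (\<lambda>t. of_real t ^ k * sin (\<omega> * of_real t)))))) \<midarrow>w\<rightarrow> G w"
      by (rule Lim_transform_eventually)
  qed
  show "(\<lambda>w. s_approx f N \<beta> w x) holomorphic_on UNIV"
    using G by (simp add: eq)
  show "w * s_approx f N \<beta> w x = s_numerator N \<beta> w x" if "w \<noteq> 0"
    using that by (simp add: eq G_def H0)
qed

text \<open>The difference e = w u - sin(w x) solves e'' = q e - w^2 e + q sin(w x) with zero
  initial data. The forcing goes into \<open>g\<close>, which gives the extra decay 1/|w|.\<close>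

lemma solution_asymptotics:
  assumes u: "ivp_solution b q (w\<^sup>2) 0 1 u" and w: "1 \<le> norm w"
    and Q: "\<And>x. x \<in> {0..b} \<Longrightarrow> norm (q x) \<le> Q"
  shows "norm (w * u b - sin (w * of_real b)) \<le> Q / norm w * b * exp (Q * b) * exp (\<bar>Im w\<bar> * b)"
proof -
  obtain u' where u: "\<And>x. x \<in> {0..b} \<Longrightarrow> (u has_vector_derivative u' x) (at x within {0..b})"
      "\<And>x. x \<in> {0..b} \<Longrightarrow> (u' has_vector_derivative q x * u x - w\<^sup>2 * u x) (at x within {0..b})"
      "u 0 = 0" "u' 0 = 1"
    using ivp_solutionE[OF u] by metis
  have "norm (w * u b - sin (w * of_real b)) \<le> (Q / norm w + 0) * b * exp (Q * b) * exp (\<bar>Im w\<bar> * b)"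
  proof (rule perturbation_bound[where e' = "\<lambda>x. w * u' x - w * cos (w * of_real x)" and q = q
        and g = "\<lambda>x. q x * sin (w * of_real x)" and p = "\<lambda>_. 0" and p' = "\<lambda>_. 0"])
    fix x assume x: "x \<in> {0..b}"
    show "((\<lambda>x. w * u x - sin (w * of_real x)) has_vector_derivative w * u' x - w * cos (w * of_real x)) (at x within {0..b})"
      by (intro has_vector_derivative_diff has_vector_derivative_mult_right u x has_vector_derivative_sin_of_real)
    show "((\<lambda>x. w * u' x - w * cos (w * of_real x)) has_vector_derivative
        q x * (w * u x - sin (w * of_real x)) - w\<^sup>2 * (w * u x - sin (w * of_real x)) +
        q x * sin (w * of_real x) + 0 * sin (w * of_real x)) (at x within {0..b})"
      using has_vector_derivative_diff[OF has_vector_derivative_mult_right[OF u(2)[OF x], of w]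
          has_vector_derivative_mult_right[OF has_vector_derivative_cos_of_real[of w], of w]]
      by (rule back_subst[where P = "\<lambda>d. (_ has_vector_derivative d) _"])
        (simp add: algebra_simps power2_eq_square)
    have "norm (sin (w * of_real x)) \<le> exp (\<bar>Im w\<bar> * x)"
      using norm_sin_le_exp_Im[of "w * of_real x"] x by (simp add: abs_mult)
    then show "norm (q x * sin (w * of_real x)) \<le> Q * exp (\<bar>Im w\<bar> * x)"
      unfolding norm_mult using Q[OF x] order_trans[OF norm_ge_zero Q[OF x]] by (intro mult_mono) auto
  qed (use Q w u b_pos in auto)
  then show ?thesis by simp
qed

text \<open>The bound depends on N and the coefficients only through \<open>\<delta>\<close>, and it
  holds for w times the error; this is the form required by
  \<open>sine_type_zeros_stable\<close>.\<close>

lemma approximation_bound: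
  assumes u: "ivp_solution b q (w\<^sup>2) 0 1 u" and w: "1 \<le> norm w"
    and Q: "\<And>x. x \<in> {0..b} \<Longrightarrow> norm (q x) \<le> Q"
    and \<delta>: "\<And>x. x \<in> {0..b} \<Longrightarrow>
      norm (1 / 4 * integral {0..x} q - (\<Sum>n = 1..N. \<beta> n * s_fun f n x)) \<le> \<delta>"
  shows "norm (w * s_approx f N \<beta> w b - w * u b) \<le> 4 * \<delta> * b * exp (Q * b) * exp (\<bar>Im w\<bar> * b)"
proof -
  obtain u' where u: "\<And>x. x \<in> {0..b} \<Longrightarrow> (u has_vector_derivative u' x) (at x within {0..b})"
      "\<And>x. x \<in> {0..b} \<Longrightarrow> (u' has_vector_derivative q x * u x - w\<^sup>2 * u x) (at x within {0..b})"
      "u 0 = 0" "u' 0 = 1"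
    using ivp_solutionE[OF u] by metis
  \<comment> \<open>This is -4 times the approximation defect. In the equation for w s_N the leading
    term sin(w x) leaves -q sin(w x) and the wave terms leave 4 (sum of b_n s_n') sin(w x); together
    they are exactly p' sin(w x), so \<open>g\<close> can be 0.\<close>
  define p where "p = (\<lambda>x. 4 * (\<Sum>n = 1..N. \<beta> n * s_fun f n x) - integral {0..x} q)"
  define v' where "v' = (\<lambda>x. w * cos (w * of_real x) + 2 * (\<Sum>n = 1..N. \<beta> n * wave_term' n w x))"
  have w0: "w \<noteq> 0" using w by auto
  have "norm (s_numerator N \<beta> w b - w * u b) \<le> (0 / norm w + 4 * \<delta>) * b * exp (Q * b) * exp (\<bar>Im w\<bar> * b)"
  proof (rule perturbation_bound[where e' = "\<lambda>x. v' x - w * u' x" and q = q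
        and g = "\<lambda>_. 0" and p = p and p' = "\<lambda>x. 4 * (\<Sum>n = 1..N. \<beta> n * s_fun' n x) - q x"])
    fix x assume x: "x \<in> {0..b}"
    show "((\<lambda>x. s_numerator N \<beta> w x - w * u x) has_vector_derivative v' x - w * u' x) (at x within {0..b})"
      unfolding s_numerator_def v'_def
      by (intro has_vector_derivative_diff has_vector_derivative_add has_vector_derivative_mult_right
          has_vector_derivative_sum u x has_vector_derivative_sin_of_real wave_term_deriv)
    have v': "(v' has_vector_derivative w * (- w * sin (w * of_real x)) + 2 * (\<Sum>n = 1..N. \<beta> n *
        (q x * wave_term n w x - w\<^sup>2 * wave_term n w x + 2 * s_fun' n x * sin (w * of_real x)))) (at x within {0..b})"
      unfolding v'_def
      by (intro has_vector_derivative_add has_vector_derivative_mult_right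
          has_vector_derivative_sum x has_vector_derivative_cos_of_real wave_term'_deriv)
    have sum_eq: "(\<Sum>n = 1..N. \<beta> n * (q x * wave_term n w x - w\<^sup>2 * wave_term n w x + 2 * s_fun' n x * sin (w * of_real x)))
      = (q x - w\<^sup>2) * (\<Sum>n = 1..N. \<beta> n * wave_term n w x) + 2 * sin (w * of_real x) * (\<Sum>n = 1..N. \<beta> n * s_fun' n x)"
      unfolding sum_distrib_left sum.distrib[symmetric]
      by (intro sum.cong refl) (simp only: algebra_simps)
    show "((\<lambda>x. v' x - w * u' x) has_vector_derivative
        q x * (s_numerator N \<beta> w x - w * u x) - w\<^sup>2 * (s_numerator N \<beta> w x - w * u x) + 0
        + (4 * (\<Sum>n = 1..N. \<beta> n * s_fun' n x) - q x) * sin (w * of_real x)) (at x within {0..b})"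
      using has_vector_derivative_diff[OF v' has_vector_derivative_mult_right[OF u(2)[OF x], of w]]
      by (rule back_subst[where P = "\<lambda>d. (_ has_vector_derivative d) _"])
        (unfold sum_eq, simp add: s_numerator_def algebra_simps power2_eq_square)
    show "(p has_vector_derivative 4 * (\<Sum>n = 1..N. \<beta> n * s_fun' n x) - q x) (at x within {0..b})"
      unfolding p_def
      by (intro has_vector_derivative_diff has_vector_derivative_mult_right has_vector_derivative_sum
          s_fun_deriv integral_has_vector_derivative q_cont x)
    have "p x = - (4 * (1 / 4 * integral {0..x} q - (\<Sum>n = 1..N. \<beta> n * s_fun f n x)))"
      by (simp add: p_def algebra_simps)
    then have "norm (p x) = 4 * norm (1 / 4 * integral {0..x} q - (\<Sum>n = 1..N. \<beta> n * s_fun f n x))"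
      by (simp only: norm_minus_cancel norm_mult) simp
    then show "norm (p x) \<le> 4 * \<delta>"
      using \<delta>[OF x] by simp
  next
    show "s_numerator N \<beta> w 0 - w * u 0 = 0"
      by (simp add: s_numerator_def wave_term_def sin_moment_0 u)
    have "(\<Sum>n = 1..N. \<beta> n * wave_term' n w 0) = 0"
      by (intro sum.neutral) (simp add: wave_term'_def sin_moment_0)
    then show "v' 0 - w * u' 0 = 0"
      by (simp add: v'_def u)
  qed (use Q w b_pos in auto)
  then show ?thesis by (simp add: s_approx_eq[OF w0])
qed

end

section \<open>Choice of the tolerances and transfer to the characteristic functions\<close>

theorem proposition7p1:
  fixes b :: real and q f :: "real \<Rightarrow> complex" and h :: complex
    and s :: "complex \<Rightarrow> real \<Rightarrow> complex"
  assumes "b > 0"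
    and "continuous_on {0..b} q"
    and "ivp_solution b q 0 1 h f"
    and "\<And>x. x \<in> {0..b} \<Longrightarrow> f x \<noteq> 0"
    and "\<And>\<omega>. ivp_solution b q (\<omega>\<^sup>2) 0 1 (s \<omega>)"
  shows "\<forall>\<epsilon>>0. \<exists>\<epsilon>\<^sub>1>0. \<exists>\<epsilon>\<^sub>2>0.
    \<forall>(N::nat) (\<alpha> :: nat \<Rightarrow> complex) (\<beta> :: nat \<Rightarrow> complex).
      (\<forall>x\<in>{0..b}.
         cmod (h / 2 + 1 / 4 * integral {0..x} q - (\<Sum>n = 0..N. \<alpha> n * c_fun f n x)) < \<epsilon>\<^sub>1 \<and>
         cmod (1 / 4 * integral {0..x} q - (\<Sum>n = 1..N. \<beta> n * s_fun f n x)) < \<epsilon>\<^sub>2) \<longrightarrow>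
      (\<exists>g. bij_betw g (zeros_with_mult (\<lambda>\<omega>. - s \<omega> b))
                      (zeros_with_mult (\<lambda>\<omega>. - s_approx f N \<beta> \<omega> b)) \<and>
           (\<forall>p \<in> zeros_with_mult (\<lambda>\<omega>. - s \<omega> b). cmod (fst (g p) - fst p) \<le> \<epsilon>))"
proof (intro allI impI)
  fix \<epsilon> :: real assume \<epsilon>: "0 < \<epsilon>"
  note q = assms(2) and f = assms(3) and s = assms(5)
  obtain f' where "\<And>x. x \<in> {0..b} \<Longrightarrow> (f has_vector_derivative f' x) (at x within {0..b})"
      "\<And>x. x \<in> {0..b} \<Longrightarrow> (f' has_vector_derivative q x * f x - 0 * f x) (at x within {0..b})"
      "f 0 = 1"
    using ivp_solutionE[OF f] by metis
  then interpret nonvanishing_solution b q f f'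
    using assms(1,2,4) by unfold_locales auto
  obtain Q where Q: "\<And>x. x \<in> {0..b} \<Longrightarrow> norm (q x) \<le> Q"
    using compact_imp_bounded[OF compact_continuous_image[OF q compact_Icc]]
    by (fastforce simp: bounded_iff)
  define A where "A = b * exp (Q * b)"
  have A: "0 < A" using \<open>b > 0\<close> by (simp add: A_def)
  have "norm (w * s w b - sin (w * of_real b)) \<le> (Q * A) / norm w * exp (\<bar>Im w\<bar> * b)"
    if "1 \<le> norm w" for w
    using solution_asymptotics[OF s that Q] by (simp add: A_def mult_ac)
  from sine_type_zeros_stable[OF \<open>b > 0\<close> ivp_solution_holomorphic[OF s] \<epsilon> this]
  obtain \<delta> where \<delta>: "0 < \<delta>"
    and match: "\<And>\<Psi>. \<Psi> holomorphic_on UNIV \<Longrightarrow>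
      (\<And>w. 1 \<le> norm w \<Longrightarrow> norm (w * \<Psi> w - w * s w b) \<le> \<delta> * exp (\<bar>Im w\<bar> * b)) \<Longrightarrow>
      \<exists>h. bij_betw h (zeros_with_mult (\<lambda>\<omega>. s \<omega> b)) (zeros_with_mult \<Psi>) \<and>
        (\<forall>p\<in>zeros_with_mult (\<lambda>\<omega>. s \<omega> b). norm (fst (h p) - fst p) \<le> \<epsilon>)"
    by blast
  have minus: "zeros_with_mult (\<lambda>\<omega>. - F \<omega>) = zeros_with_mult F" for F :: "complex \<Rightarrow> complex"
    by (simp add: zeros_with_mult_def)
  have "\<exists>g. bij_betw g (zeros_with_mult (\<lambda>\<omega>. - s \<omega> b)) (zeros_with_mult (\<lambda>\<omega>. - s_approx f N \<beta> \<omega> b)) \<and>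
      (\<forall>p\<in>zeros_with_mult (\<lambda>\<omega>. - s \<omega> b). norm (fst (g p) - fst p) \<le> \<epsilon>)"
    if close: "\<And>x. x \<in> {0..b} \<Longrightarrow>
      norm (1 / 4 * integral {0..x} q - (\<Sum>n = 1..N. \<beta> n * s_fun f n x)) < \<delta> / (4 * A)"
    for N \<beta>
    unfolding minus
  proof (rule match[OF s_approx_holomorphic])
    fix w :: complex assume w: "1 \<le> norm w"
    have "norm (w * s_approx f N \<beta> w b - w * s w b)
        \<le> 4 * (\<delta> / (4 * A)) * b * exp (Q * b) * exp (\<bar>Im w\<bar> * b)"
      by (rule approximation_bound[OF s w Q less_imp_le[OF close]])
    also have "4 * (\<delta> / (4 * A)) * b * exp (Q * b) = 4 * (\<delta> / (4 * A)) * A"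
      by (simp add: A_def)
    also have "\<dots> = \<delta>"
      using A by simp
    finally show "norm (w * s_approx f N \<beta> w b - w * s w b) \<le> \<delta> * exp (\<bar>Im w\<bar> * b)" .
  qed
  moreover have "0 < \<delta> / (4 * A)" using \<delta> A by simp
  ultimately show "\<exists>\<epsilon>\<^sub>1>0. \<exists>\<epsilon>\<^sub>2>0.
    \<forall>(N::nat) (\<alpha> :: nat \<Rightarrow> complex) (\<beta> :: nat \<Rightarrow> complex).
      (\<forall>x\<in>{0..b}.
         cmod (h / 2 + 1 / 4 * integral {0..x} q - (\<Sum>n = 0..N. \<alpha> n * c_fun f n x)) < \<epsilon>\<^sub>1 \<and>
         cmod (1 / 4 * integral {0..x} q - (\<Sum>n = 1..N. \<beta> n * s_fun f n x)) < \<epsilon>\<^sub>2) \<longrightarrow>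
      (\<exists>g. bij_betw g (zeros_with_mult (\<lambda>\<omega>. - s \<omega> b))
                      (zeros_with_mult (\<lambda>\<omega>. - s_approx f N \<beta> \<omega> b)) \<and>
           (\<forall>p \<in> zeros_with_mult (\<lambda>\<omega>. - s \<omega> b). cmod (fst (g p) - fst p) \<le> \<epsilon>))"
    by (intro exI[of _ 1] exI[of _ "\<delta> / (4 * A)"] conjI allI impI) auto
qed

end
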